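(* Let $\mathcal{A}$ and $\mathcal{B}$ be complex unital $C^{\star}$-algebras with nonzero identities, let $T:\mathcal{A}\to\mathcal{B}$ be a bounded homomorphism which has the strong Riesz property, and let $a\in\mathcal{A}$. Then $a$ is a polynomial $T$-Riesz element if and only if the $T$-Weyl spectrum $\omega_{T}(a)$ is finite. In this case there is a decomposition $a=c+d+f$ with $c,d,f\in\mathcal{A}$ such that $c\in T^{-1}(0)$, $d\in QN(\mathcal{A})$ and $\sigma_{\mathcal{A}}(f)=\omega_{T}(a)$.
   Context: A homomorphism $T:\mathcal{A}\to\mathcal{B}$ is a unital homomorphism of complex algebras (it maps invertible elements to invertible elements); it is not assumed to preserve the involution. $T^{-1}(0)=\{a\in\mathcal{A}: Ta=0\}$. $\mathcal{A}^{-1}$ is the set of invertible elements of $\mathcal{A}$, $e$ is the identity, and $\sigma_{\mathcal{A}}(a)$ is the spectrum of $a$ in $\mathcal{A}$. $QN(\mathcal{A})$ is the set of quasinilpotent elements of $\mathcal{A}$ (those with spectrum $\{0\}$), and similarly for $\mathcal{B}$. For a compact set $K\subseteq\mathbb{C}$, $\mathrm{iso}(K)$ is the set of its isolated points and $\partial K$ its topological boundary. $\sigma_{T}(a)=\sigma_{\mathcal{B}}(Ta)$ is the spectrum of $Ta$ in $\mathcal{B}$. An element of $\mathcal{A}$ is $T$-Weyl if it belongs to $T^{-1}(0)+\mathcal{A}^{-1}=\{c+d: c\in T^{-1}(0),\ d\in\mathcal{A}^{-1}\}$, and the $T$-Weyl spectrum of $a$ is $\omega_{T}(a)=\{\lambda\in\mathbb{C}: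 \lambda e-a \text{ is not } T\text{-Weyl}\}$. $T$ has the strong Riesz property if $\partial\sigma_{\mathcal{A}}(a)\subseteq\sigma_{T}(a)\cup\mathrm{iso}(\sigma_{\mathcal{A}}(a))$ for every $a\in\mathcal{A}$. An element $a\in\mathcal{A}$ is $T$-Riesz if $Ta\in QN(\mathcal{B})$; it is polynomial $T$-Riesz (written $a\in poly^{-1}T^{-1}(QN(\mathcal{B}))$) if there is a non-zero complex polynomial $P$ such that $P(a)$ is $T$-Riesz. *)

theory Defs
  imports "HOL-Analysis.Analysis" "HOL-Computational_Algebra.Polynomial"
begin

class complex_banach_algebra_1 = real_normed_algebra_1 + banach +
  fixes scaleC :: "complex \<Rightarrow> 'a \<Rightarrow> 'a"  (infixr \<open>*\<^sub>C\<close> 75)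
  assumes scaleC_add_right: "c *\<^sub>C (x + y) = c *\<^sub>C x + c *\<^sub>C y"
    and scaleC_add_left: "(b + c) *\<^sub>C x = b *\<^sub>C x + c *\<^sub>C x"
    and scaleC_scaleC: "b *\<^sub>C (c *\<^sub>C x) = (b * c) *\<^sub>C x"
    and scaleR_scaleC: "r *\<^sub>R x = complex_of_real r *\<^sub>C x"
    and mult_scaleC_left: "(c *\<^sub>C x) * y = c *\<^sub>C (x * y)"
    and mult_scaleC_right: "x * (c *\<^sub>C y) = c *\<^sub>C (x * y)"
    and norm_scaleC: "norm (c *\<^sub>C x) = cmod c * norm x"

text \<open>
  The superclass contributes \<open>0 \<noteq> 1\<close> and \<open>norm 1 = 1\<close>. In a C*-algebra with nonzero
  identity the latter is no restriction: it follows from the C*-identity.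
\<close>

class cstar_algebra_1 = complex_banach_algebra_1 +
  fixes star :: "'a \<Rightarrow> 'a"
  assumes star_add: "star (x + y) = star x + star y"
    and star_scaleC: "star (c *\<^sub>C x) = cnj c *\<^sub>C star x"
    and star_mult: "star (x * y) = star y * star x"
    and star_star: "star (star x) = x"
    and cstar_identity: "norm (star x * x) = (norm x)\<^sup>2"

definition invertible_elems :: "'a::monoid_mult set" where
  "invertible_elems = {x. \<exists>y. x * y = 1 \<and> y * x = 1}"

definition alg_spectrum :: "'a::complex_banach_algebra_1 \<Rightarrow> complex set" where
  "alg_spectrum x = {l. l *\<^sub>C 1 - x \<notin> invertible_elems}"

definition quasinilpotents :: "'a::complex_banach_algebra_1 set" where
  "quasinilpotents = {x. alg_spectrum x = {0}}"

definition alg_poly :: "complex poly \<Rightarrow> 'a::complex_banach_algebra_1 \<Rightarrow> 'a" where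
  "alg_poly P x = (\<Sum>i\<le>degree P. coeff P i *\<^sub>C x ^ i)"

definition unital_hom :: "('a::complex_banach_algebra_1 \<Rightarrow> 'b::complex_banach_algebra_1) \<Rightarrow> bool" where
  "unital_hom T \<longleftrightarrow>
     (\<forall>x y. T (x + y) = T x + T y) \<and> (\<forall>c x. T (c *\<^sub>C x) = c *\<^sub>C T x) \<and>
     (\<forall>x y. T (x * y) = T x * T y) \<and> T 1 = 1"

definition hom_kernel :: "('a::complex_banach_algebra_1 \<Rightarrow> 'b::complex_banach_algebra_1) \<Rightarrow> 'a set" where
  "hom_kernel T = {x. T x = 0}"

definition hom_spectrum ::
  "('a::complex_banach_algebra_1 \<Rightarrow> 'b::complex_banach_algebra_1) \<Rightarrow> 'a \<Rightarrow> complex set" where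
  "hom_spectrum T x = alg_spectrum (T x)"

definition hom_weyl :: "('a::complex_banach_algebra_1 \<Rightarrow> 'b::complex_banach_algebra_1) \<Rightarrow> 'a set" where
  "hom_weyl T = {c + d | c d. c \<in> hom_kernel T \<and> d \<in> invertible_elems}"

definition weyl_spectrum ::
  "('a::complex_banach_algebra_1 \<Rightarrow> 'b::complex_banach_algebra_1) \<Rightarrow> 'a \<Rightarrow> complex set" where
  "weyl_spectrum T x = {l. l *\<^sub>C 1 - x \<notin> hom_weyl T}"

definition iso_points :: "complex set \<Rightarrow> complex set" where
  "iso_points K = {z. z isolated_in K}"

definition strong_riesz_property ::
  "('a::complex_banach_algebra_1 \<Rightarrow> 'b::complex_banach_algebra_1) \<Rightarrow> bool" where
  "strong_riesz_property T \<longleftrightarrow>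
     (\<forall>x. frontier (alg_spectrum x) \<subseteq> hom_spectrum T x \<union> iso_points (alg_spectrum x))"

definition hom_riesz ::
  "('a::complex_banach_algebra_1 \<Rightarrow> 'b::complex_banach_algebra_1) \<Rightarrow> 'a \<Rightarrow> bool" where
  "hom_riesz T x \<longleftrightarrow> T x \<in> quasinilpotents"

definition poly_hom_riesz ::
  "('a::complex_banach_algebra_1 \<Rightarrow> 'b::complex_banach_algebra_1) \<Rightarrow> 'a \<Rightarrow> bool" where
  "poly_hom_riesz T x \<longleftrightarrow> (\<exists>P. P \<noteq> 0 \<and> hom_riesz T (alg_poly P x))"

end

theory Submission
  imports Defs "HOL-Computational_Algebra.Fundamental_Theorem_Algebra"
begin

text \<open>
  If \<open>\<sigma>\<^sub>T(a)\<close> is finite, the strong Riesz property forces \<open>\<sigma>(a)\<close> to consist of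
  \<open>\<Lambda> = \<sigma>\<^sub>T(a)\<close> and of isolated points \<open>\<mu>\<^sub>k\<close> accumulating only at \<open>\<Lambda>\<close>, whose spectral
  idempotents lie in the kernel of \<open>T\<close>; hence \<open>\<omega>\<^sub>T(a) = \<Lambda>\<close>. By polynomial spectral mapping,
  finiteness of \<open>\<sigma>\<^sub>T(a)\<close> is equivalent to \<open>a\<close> being polynomial \<open>T\<close>-Riesz.

  For the decomposition, let \<open>s\<^sub>n\<close> be the self-adjoint range projection of the sum of the first
  \<open>n\<close> spectral idempotents. Then \<open>a\<close> is upper triangular with respect to the orthogonal
  projections \<open>q\<^sub>k = s\<^sub>k\<^sub>+\<^sub>1 - s\<^sub>k\<close>, with \<open>k\<close>-th diagonal block of spectrum \<open>{\<mu>\<^sub>k}\<close>. If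
  \<open>\<nu>\<^sub>k \<in> \<Lambda>\<close> is nearest to \<open>\<mu>\<^sub>k\<close>, the series \<open>c = \<Sum>\<^sub>k (\<mu>\<^sub>k - \<nu>\<^sub>k) q\<^sub>k\<close> converges in the
  kernel, and moves every diagonal block into \<open>\<Lambda>\<close>. A boundary point of \<open>\<sigma>(a - c)\<close> outside
  \<open>\<Lambda>\<close> would be an approximate left eigenvalue of \<open>a - c\<close>; its approximate eigenvectors are
  annihilated by all \<open>s\<^sub>n\<close>, hence by \<open>c\<close>, hence are approximate left eigenvectors of \<open>a\<close>
  annihilated by all the spectral idempotents, which is impossible. So \<open>\<sigma>(a - c) = \<Lambda>\<close>, and
  one can take \<open>f = a - c\<close> and \<open>d = 0\<close>.
\<close>

section \<open>Invertible elements and the spectrum in a Banach algebra\<close>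

interpretation scaleC: bounded_bilinear "scaleC :: complex \<Rightarrow> 'a \<Rightarrow> 'a::complex_banach_algebra_1"
proof
  show "\<exists>K. \<forall>c (x::'a). norm (c *\<^sub>C x) \<le> norm c * norm x * K"
    by (rule exI[of _ 1]) (simp add: norm_scaleC)
qed (simp_all add: scaleC_add_left scaleC_add_right scaleR_scaleC scaleC_scaleC
    scaleR_conv_of_real mult.commute)

lemma scaleC_one [simp]: "1 *\<^sub>C (x::'a::complex_banach_algebra_1) = x"
  using scaleR_scaleC[of 1 x] by simp

lemmas scaleC_assoc = scaleC_scaleC mult_scaleC_left mult_scaleC_right

lemma scaleC_power: "(c *\<^sub>C (x::'a::complex_banach_algebra_1)) ^ n = c ^ n *\<^sub>C x ^ n"
  by (induction n) (simp_all add: scaleC_assoc mult.commute)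

definition ainv :: "'a::monoid_mult \<Rightarrow> 'a" where
  "ainv x = (THE y. x * y = 1 \<and> y * x = 1)"

lemma ainv_eq:
  assumes "x * y = 1" "y * x = 1" shows "ainv x = y"
  unfolding ainv_def
proof (rule the_equality)
  fix z assume "x * z = 1 \<and> z * x = 1"
  then have "z = z * (x * y)" "z * x = 1" using assms by simp_all
  then show "z = y" by (metis mult.assoc mult_1)
qed (use assms in simp)

lemma invertibleI: "x * y = 1 \<Longrightarrow> y * x = 1 \<Longrightarrow> x \<in> invertible_elems"
  unfolding invertible_elems_def by blast

lemma ainv:
  assumes "x \<in> invertible_elems" shows "x * ainv x = 1" "ainv x * x = 1"
  using assms ainv_eq unfolding invertible_elems_def by blast+

lemma ainv_cancel:
  assumes "x \<in> invertible_elems"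
  shows "x * (ainv x * y) = y" "ainv x * (x * y) = y"
  by (simp_all add: ainv[OF assms] flip: mult.assoc)

lemma invertible_mult:
  assumes "x \<in> invertible_elems" "y \<in> invertible_elems"
  shows "x * y \<in> invertible_elems"
  by (rule invertibleI[of _ "ainv y * ainv x"])
    (simp_all add: mult.assoc ainv_cancel assms ainv)

text \<open>If \<open>z\<close> inverts \<open>x * y\<close>, then \<open>y * z\<close> is a right
  inverse of \<open>x\<close> and, by commutation, \<open>z * y\<close> is a left inverse;
  associativity forces the two to agree.\<close>

lemma invertible_factor:
  assumes "x * y = y * x" "x * y \<in> invertible_elems"
  shows "x \<in> invertible_elems"
proof -
  define z where "z = ainv (x * y)"
  have z: "x * y * z = 1" "z * (x * y) = 1" using ainv[OF assms(2)] by (simp_all add: z_def)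
  have "x * (y * z) = 1" using z(1) by (simp add: mult.assoc)
  moreover have "z * y * x = 1" using z(2) assms(1) by (simp add: mult.assoc)
  moreover have "z * y = y * z"
  proof -
    have "z * y = z * y * (x * (y * z))" by (simp only: \<open>x * (y * z) = 1\<close> mult_1_right)
    also have "\<dots> = z * y * x * (y * z)" by (simp only: mult.assoc)
    also have "\<dots> = y * z" by (simp only: \<open>z * y * x = 1\<close> mult_1_left)
    finally show ?thesis .
  qed
  ultimately show ?thesis by (intro invertibleI[of _ "y * z"]) simp_all
qed

lemma commute_ainv:
  assumes "x \<in> invertible_elems" "y * x = x * y"
  shows "y * ainv x = ainv x * y"
proof -
  have "ainv x * (y * x) * ainv x = ainv x * (x * y) * ainv x" using assms by simp
  then show ?thesis using assms(1) by (simp add: mult.assoc ainv ainv_cancel)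
qed

lemma invertible_scaleC:
  fixes x :: "'a::complex_banach_algebra_1"
  assumes "c \<noteq> 0"
  shows "c *\<^sub>C x \<in> invertible_elems \<longleftrightarrow> x \<in> invertible_elems"
proof -
  have *: "c *\<^sub>C x \<in> invertible_elems" if "c \<noteq> 0" "x \<in> invertible_elems" for c and x :: 'a
    by (rule invertibleI[of _ "(1 / c) *\<^sub>C ainv x"])
      (use that in \<open>simp_all add: scaleC_assoc ainv\<close>)
  from *[of "1 / c" "c *\<^sub>C x"] *[of c x] assms show ?thesis by (auto simp: scaleC_scaleC)
qed

lemma invertible_uminus:
  "- (x::'a::complex_banach_algebra_1) \<in> invertible_elems \<longleftrightarrow> x \<in> invertible_elems"
  using invertible_scaleC[of "-1" x] by (simp add: scaleC.minus_left)

lemma neumann: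
  fixes x :: "'a::complex_banach_algebra_1"
  assumes "norm x < 1"
  shows "1 - x \<in> invertible_elems"
proof -
  have s: "summable (\<lambda>n. x ^ n)" by (rule complete_algebra_summable_geometric[OF assms])
  define y where "y = (\<Sum>n. x ^ n)"
  have "x * y = (\<Sum>n. x ^ Suc n)" "y * x = (\<Sum>n. x ^ Suc n)"
    unfolding y_def using s by (simp_all add: suminf_mult suminf_mult2 power_commutes)
  moreover have "y = 1 + (\<Sum>n. x ^ Suc n)"
    unfolding y_def using suminf_split_head[OF s] by simp
  ultimately show ?thesis
    by (intro invertibleI[of _ y]) (simp_all add: algebra_simps)
qed

text \<open>The commuting factor \<open>\<Sum>i<n. x ^ i\<close> turns \<open>1 - x\<close> into
  \<open>1 - x ^ n\<close>, so one power of norm below 1 suffices. This does the work of the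
  spectral radius formula.\<close>

lemma neumann_power:
  fixes x :: "'a::complex_banach_algebra_1"
  assumes "norm (x ^ n) < 1"
  shows "1 - x \<in> invertible_elems"
proof (rule invertible_factor)
  show "(1 - x) * (\<Sum>i<n. x ^ i) = (\<Sum>i<n. x ^ i) * (1 - x)"
    by (simp add: left_diff_distrib right_diff_distrib sum_distrib_left sum_distrib_right power_commutes
        sum_subtractf)
  have "(1 - x) * (\<Sum>i<n. x ^ i) = 1 - x ^ n"
    using sum_lessThan_telescope'[of "power x" n]
    by (simp add: left_diff_distrib sum_distrib_left sum_subtractf)
  then show "(1 - x) * (\<Sum>i<n. x ^ i) \<in> invertible_elems" using neumann[OF assms] by simp
qed

text \<open>\<open>x - h = x * (1 - ainv x * h)\<close> reduces invertibility to a Neumann series.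
  The new inverse \<open>y\<close> satisfies \<open>y = ainv x + ainv x * h * y\<close>, and the
  last term costs at most half of \<open>norm y\<close>.\<close>

lemma perturb_invertible:
  fixes x :: "'a::complex_banach_algebra_1"
  assumes "x \<in> invertible_elems" "norm h * norm (ainv x) \<le> 1 / 2"
  shows "x - h \<in> invertible_elems" "norm (ainv (x - h)) \<le> 2 * norm (ainv x)"
proof -
  have "norm (ainv x * h) \<le> norm h * norm (ainv x)" by (metis norm_mult_ineq mult.commute)
  then have le: "norm (ainv x * h) \<le> 1 / 2" using assms by simp
  then have "1 - ainv x * h \<in> invertible_elems" by (intro neumann) simp
  moreover have eq: "x - h = x * (1 - ainv x * h)"
    using assms by (simp add: algebra_simps ainv_cancel)
  ultimately show inv: "x - h \<in> invertible_elems" using invertible_mult assms(1) by metis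
  define y where "y = ainv (x - h)"
  have "ainv x * ((x - h) * y) = ainv x" using ainv[OF inv] by (simp add: y_def)
  then have "y = ainv x + ainv x * h * y"
    using assms by (simp add: algebra_simps ainv_cancel)
  then have "norm y \<le> norm (ainv x) + norm (ainv x * h) * norm y"
    by (metis norm_triangle_le norm_mult_ineq add_left_mono order.trans norm_triangle_ineq)
  also have "\<dots> \<le> norm (ainv x) + 1 / 2 * norm y" using le by (intro add_left_mono mult_right_mono) auto
  finally show "norm (ainv (x - h)) \<le> 2 * norm (ainv x)" by (simp add: y_def)
qed

lemma invertible_shift_iff:
  fixes x :: "'a::complex_banach_algebra_1"
  shows "x - l *\<^sub>C 1 \<in> invertible_elems \<longleftrightarrow> l \<notin> alg_spectrum x"
  using invertible_uminus[of "l *\<^sub>C 1 - x"] by (simp add: alg_spectrum_def)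

section \<open>Topology and boundary of the spectrum\<close>

lemma open_resolvent_set: "open (- alg_spectrum (x::'a::complex_banach_algebra_1))"
  unfolding open_dist
proof
  fix l assume "l \<in> - alg_spectrum x"
  then have inv: "l *\<^sub>C 1 - x \<in> invertible_elems" by (simp add: alg_spectrum_def)
  define K where "K = norm (ainv (l *\<^sub>C 1 - x)) + 1"
  have K: "K > 0" by (simp add: K_def add_nonneg_pos)
  have "k \<in> - alg_spectrum x" if "dist k l < 1 / (2 * K)" for k
  proof -
    have "norm ((l - k) *\<^sub>C (1::'a)) * norm (ainv (l *\<^sub>C 1 - x)) \<le> 1 / (2 * K) * K"
      using that K by (intro mult_mono) (auto simp: norm_scaleC dist_norm norm_minus_commute K_def)
    then have "l *\<^sub>C 1 - x - (l - k) *\<^sub>C 1 \<in> invertible_elems"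
      using K by (intro perturb_invertible(1)[OF inv]) simp
    then show ?thesis by (simp add: alg_spectrum_def scaleC.diff_left)
  qed
  then show "\<exists>e>0. \<forall>k. dist k l < e \<longrightarrow> k \<in> - alg_spectrum x"
    using K by (intro exI[of _ "1 / (2 * K)"]) auto
qed

lemma closed_spectrum: "closed (alg_spectrum (x::'a::complex_banach_algebra_1))"
  using open_resolvent_set by (simp add: closed_def)

lemma spectrum_norm_le:
  assumes "l \<in> alg_spectrum (x::'a::complex_banach_algebra_1)"
  shows "norm l \<le> norm x"
proof (rule ccontr)
  assume *: "\<not> norm l \<le> norm x"
  then have l: "l \<noteq> 0" by auto
  have "norm ((1 / l) *\<^sub>C x) < 1" using * l by (simp add: norm_scaleC norm_divide)
  then have "l *\<^sub>C (1 - (1 / l) *\<^sub>C x) \<in> invertible_elems"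
    using neumann invertible_scaleC[OF l] by blast
  then show False using assms l by (simp add: alg_spectrum_def scaleC.diff_right scaleC_scaleC)
qed

lemma bounded_spectrum: "bounded (alg_spectrum (x::'a::complex_banach_algebra_1))"
  unfolding bounded_iff using spectrum_norm_le by blast

text \<open>Resolvents blow up near a boundary point. Normalised resolvents, taken at resolvent
  points \<open>m k\<close> tending to \<open>l\<close>, are the approximate left
  eigenvectors.\<close>

lemma frontier_spectrum_approx:
  fixes x :: "'a::complex_banach_algebra_1"
  assumes "l \<in> frontier (alg_spectrum x)"
  obtains y :: "nat \<Rightarrow> 'a" where "\<And>k. norm (y k) = 1" "(\<lambda>k. y k * (l *\<^sub>C 1 - x)) \<longlonglongrightarrow> 0"
proof -
  have lx: "l \<in> alg_spectrum x"
    using assms closed_spectrum[of x] by (auto simp: frontier_def)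
  have "l \<in> closure (- alg_spectrum x)"
    using assms by (simp add: frontier_closures)
  then obtain m where m: "\<And>k. m k \<notin> alg_spectrum x" "m \<longlonglongrightarrow> l"
    unfolding closure_sequential by auto
  define z where "z k = m k *\<^sub>C 1 - x" for k
  have z: "z k \<in> invertible_elems" for k using m(1) by (simp add: z_def alg_spectrum_def)
  define r where "r k = norm (ainv (z k))" for k
  have r0: "r k > 0" for k
    using ainv[OF z[of k]] by (auto simp: r_def)
  \<comment> \<open>A smaller product would let \<open>perturb_invertible\<close> carry
    invertibility from \<open>z k\<close> over to \<open>l *\<^sub>C 1 - x\<close>.\<close>
  have dl: "norm (m k - l) * r k > 1 / 2" for k
  proof (rule ccontr)
    assume "\<not> ?thesis"
    then have "z k - (m k - l) *\<^sub>C 1 \<in> invertible_elems"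
      using z by (intro perturb_invertible(1)) (simp_all add: r_def norm_scaleC)
    then show False using lx by (simp add: z_def scaleC.diff_left alg_spectrum_def)
  qed
  define y where "y k = (1 / r k) *\<^sub>R ainv (z k)" for k
  have "y k * (l *\<^sub>C 1 - x) = (1 / r k) *\<^sub>R 1 - (m k - l) *\<^sub>C y k" for k
  proof -
    have "y k * (l *\<^sub>C 1 - x) = y k * z k - y k * ((m k - l) *\<^sub>C 1)"
      by (simp add: z_def scaleC.diff_left algebra_simps)
    then show ?thesis using ainv[OF z] by (simp add: y_def scaleC_assoc)
  qed
  then have y_eq: "y k * (l *\<^sub>C 1 - x) = (1 / r k) *\<^sub>R 1 - (m k - l) *\<^sub>C y k" for k .
  have "norm (y k * (l *\<^sub>C 1 - x)) \<le> 3 * norm (m k - l)" for k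
  proof -
    have "norm (y k * (l *\<^sub>C 1 - x)) \<le> 1 / r k + norm (m k - l) * norm (y k)"
      using r0[of k] norm_triangle_ineq4[of "(1 / r k) *\<^sub>R (1::'a)" "(m k - l) *\<^sub>C y k"]
      by (simp add: y_eq norm_scaleC)
    also have "norm (y k) = 1" using r0[of k] by (simp add: y_def r_def)
    also have "1 / r k \<le> 2 * norm (m k - l)" using dl[of k] r0[of k] by (simp add: field_simps)
    finally show ?thesis by simp
  qed
  then have "\<forall>\<^sub>F k in sequentially. norm (y k * (l *\<^sub>C 1 - x)) \<le> 3 * norm (m k - l)" by simp
  moreover have "(\<lambda>k. 3 * norm (m k - l)) \<longlonglongrightarrow> 0"
    using m(2) by (intro tendsto_mult_right_zero) (simp add: LIM_zero tendsto_norm_zero)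
  ultimately have "(\<lambda>k. y k * (l *\<^sub>C 1 - x)) \<longlonglongrightarrow> 0" by (rule Lim_null_comparison)
  moreover have "norm (y k) = 1" for k using r0[of k] by (simp add: y_def r_def)
  ultimately show ?thesis using that by blast
qed

text \<open>The plane minus a countable set is connected, yet the interior and the complement of
  \<open>K\<close> split it into two open pieces. The complement is nonempty because
  \<open>K\<close> is bounded, so the interior is empty.\<close>

lemma frontier_subset_imp_subset:
  fixes K :: "complex set"
  assumes "bounded K" "closed K" "countable (frontier K)"
  shows "K \<subseteq> frontier K"
proof -
  have conn: "connected (- frontier K)"
    using connected_open_diff_countable[OF _ open_UNIV connected_UNIV assms(3)]
    by (simp add: Compl_eq_Diff_UNIV)
  have "interior K = {} \<or> - K = {}"
  proof (rule ccontr)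
    assume *: "\<not> ?thesis"
    have "interior K \<inter> - K \<inter> - frontier K = {}" using interior_subset by blast
    moreover have "- frontier K \<subseteq> interior K \<union> - K"
      using assms(2) by (auto simp: frontier_def)
    moreover have "interior K \<inter> - frontier K \<noteq> {}" "- K \<inter> - frontier K \<noteq> {}"
      using * assms(2) by (auto simp: frontier_def)
    ultimately show False
      using connectedD[OF conn open_interior[of K] open_Compl[OF assms(2)]] by blast
  qed
  moreover have "- K \<noteq> {}"
  proof
    assume "- K = {}"
    then have "K = UNIV" by blast
    then show False using assms(1) not_bounded_UNIV by simp
  qed
  ultimately show ?thesis using assms(2) by (auto simp: frontier_def)
qed

section \<open>Spectral idempotents at isolated points\<close>

lemma power_two_power_null:
  fixes r :: real
  assumes "0 \<le> r" "r < 1"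
  shows "(\<lambda>m. r ^ (2 ^ m)) \<longlonglongrightarrow> 0"
proof -
  have "filterlim (\<lambda>m. 2 ^ m :: nat) at_top at_top"
  proof (rule filterlim_at_top_mono[OF filterlim_ident])
    show "\<forall>\<^sub>F m in sequentially. m \<le> (2 ^ m :: nat)"
      by (simp add: less_exp less_imp_le)
  qed
  from filterlim_compose[OF LIMSEQ_power_zero this, of r] assms show ?thesis by simp
qed

lemma norm_cis_minus_one_le: "norm (cis x - 1) \<le> \<bar>x\<bar>"
proof -
  have "norm (cis x - 1) = 2 * \<bar>sin (x / 2)\<bar>"
    using dist_exp_i_1[of x] by (simp add: cis_conv_exp)
  also have "\<dots> \<le> \<bar>x\<bar>" using abs_sin_x_le_abs_x[of "x / 2"] by simp
  finally show ?thesis .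
qed

lemma ainv_one_minus_square:
  fixes x :: "'a::complex_banach_algebra_1"
  assumes "1 - x \<in> invertible_elems" "1 + x \<in> invertible_elems"
  shows "1 - x * x \<in> invertible_elems"
    "ainv (1 - x * x) = (1 / 2) *\<^sub>R (ainv (1 - x) + ainv (1 + x))"
proof -
  have fac: "1 - x * x = (1 - x) * (1 + x)" "1 - x * x = (1 + x) * (1 - x)"
    by (simp_all add: algebra_simps)
  show "1 - x * x \<in> invertible_elems" unfolding fac(1) using assms by (rule invertible_mult)
  let ?u = "ainv (1 - x)" and ?v = "ainv (1 + x)"
  have "(1 - x * x) * ?u = 1 + x" "(1 - x * x) * ?v = 1 - x"
    by (metis fac mult.assoc assms ainv(1) mult_1_right)+
  moreover have "?u * (1 - x * x) = 1 + x" "?v * (1 - x * x) = 1 - x"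
    by (metis fac assms ainv_cancel(2))+
  ultimately show "ainv (1 - x * x) = (1 / 2) *\<^sub>R (?u + ?v)"
    by (intro ainv_eq) (simp_all add: distrib_left distrib_right flip: scaleR_add_right scaleR_2)
qed

lemma ainv_diff:
  assumes "x \<in> invertible_elems" "y \<in> invertible_elems"
  shows "ainv x - ainv y = ainv x * (y - x) * ainv (y::'a::complex_banach_algebra_1)"
  using assms by (simp add: algebra_simps ainv ainv_cancel)

text \<open>
  In terms of \<open>t = 1 / z\<close>, the hypothesis says that the circles of radius at most \<open>1 / t\<^sub>0\<close>
  around the centre \<open>0\<close> miss the spectrum of \<open>b\<close>. By the identity
  \<open>1 / (1 - x\<^sup>2) = (1 / (1 - x) + 1 / (1 + x)) / 2\<close>, the elements \<open>pow_inv m t\<close> are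
  the Riemann sums, over the \<open>2 ^ m\<close>-th roots of unity, of the contour integral that defines
  the spectral idempotent of \<open>b\<close> at \<open>0\<close>.
\<close>

locale punctured_resolvent =
  fixes b :: "'a::complex_banach_algebra_1" and t0 :: real
  assumes t0_pos: "0 < t0"
    and resolvent: "\<And>t. t0 \<le> norm t \<Longrightarrow> 1 - t *\<^sub>C b \<in> invertible_elems"
begin

definition pow_inv :: "nat \<Rightarrow> complex \<Rightarrow> 'a" where
  "pow_inv m t = ainv (1 - (t *\<^sub>C b) ^ (2 ^ m))"

text \<open>\<open>cis (pi / 2 ^ m)\<close> is a \<open>2 ^ m\<close>-th root of -1. Rotating
  \<open>t\<close> by it turns \<open>1 - x\<close> into \<open>1 + x\<close> without changing the
  modulus, which is what drives the doubling from \<open>m\<close> to \<open>Suc m\<close>.\<close>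

lemma half_turn: "((cis (pi / 2 ^ m) * t) *\<^sub>C b) ^ (2 ^ m) = - ((t *\<^sub>C b) ^ (2 ^ m))"
proof -
  have "cis (pi / 2 ^ m) ^ (2 ^ m) = -1" by (subst Complex.DeMoivre) simp
  then show ?thesis by (simp add: scaleC_power power_mult_distrib scaleC.minus_left)
qed

lemma pow_invertible:
  "t0 \<le> norm t \<Longrightarrow> 1 - (t *\<^sub>C b) ^ (2 ^ m) \<in> invertible_elems"
proof (induction m arbitrary: t)
  case 0
  then show ?case using resolvent by simp
next
  case (Suc m)
  have "1 + (t *\<^sub>C b) ^ (2 ^ m) \<in> invertible_elems"
    using Suc.IH[of "cis (pi / 2 ^ m) * t"] Suc.prems by (simp add: half_turn norm_mult)
  from ainv_one_minus_square(1)[OF Suc.IH this] Suc.prems show ?case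
    by (simp add: mult_2 power_add)
qed

lemma pow_inv_Suc:
  assumes "t0 \<le> norm t"
  shows "pow_inv (Suc m) t = (1 / 2) *\<^sub>R (pow_inv m t + pow_inv m (cis (pi / 2 ^ m) * t))"
proof -
  have "1 + (t *\<^sub>C b) ^ (2 ^ m) \<in> invertible_elems"
    using pow_invertible[of "cis (pi / 2 ^ m) * t" m] assms by (simp add: half_turn norm_mult)
  from ainv_one_minus_square(2)[OF pow_invertible this] assms show ?thesis
    by (simp add: pow_inv_def half_turn) (simp add: mult_2 power_add)
qed

text \<open>The resolvent is continuous on the compact annulus between the radii \<open>t0\<close>
  and \<open>t1\<close>: near \<open>t\<close> its norm is at most twice the value at
  \<open>t\<close>, and \<open>ainv_diff\<close> then controls the difference.\<close>

lemma pow_inv_0_bounded: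
  obtains M where "0 < M" "\<And>t. t0 \<le> norm t \<Longrightarrow> norm t \<le> t1 \<Longrightarrow> norm (pow_inv 0 t) \<le> M"
proof -
  define A where "A = {t::complex. t0 \<le> norm t \<and> norm t \<le> t1}"
  have "A = cball 0 t1 \<inter> - ball 0 t0" by (auto simp: A_def)
  then have "compact A" by (simp add: compact_Int_closed closed_Compl)
  have cont: "continuous_on A (pow_inv 0)"
    unfolding continuous_on_def
  proof
    fix t assume t: "t \<in> A"
    then have inv: "1 - t *\<^sub>C b \<in> invertible_elems" using resolvent by (simp add: A_def)
    define K where "K = norm (ainv (1 - t *\<^sub>C b))"
    have lim: "((\<lambda>s. norm ((s - t) *\<^sub>C b) * K) \<longlongrightarrow> 0) (at t within A)"
    proof -
      have "((\<lambda>s. norm ((s - t) *\<^sub>C b) * K) \<longlongrightarrow> norm ((t - t) *\<^sub>C b) * K) (at t within A)"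
        by (intro tendsto_intros scaleC.tendsto)
      then show ?thesis by (simp add: scaleC.zero_left)
    qed
    then have "\<forall>\<^sub>F s in at t within A. norm ((s - t) *\<^sub>C b) * K < 1 / 2"
      by (rule order_tendstoD) simp
    moreover have "\<forall>\<^sub>F s in at t within A. s \<in> A" by (simp add: eventually_at_topological) blast
    ultimately have "\<forall>\<^sub>F s in at t within A.
      norm (pow_inv 0 s - pow_inv 0 t) \<le> 2 * K * (norm ((s - t) *\<^sub>C b) * K)"
    proof eventually_elim
      case (elim s)
      have eq: "1 - s *\<^sub>C b = 1 - t *\<^sub>C b - (s - t) *\<^sub>C b" by (simp add: scaleC.diff_left)
      have inv': "1 - s *\<^sub>C b \<in> invertible_elems" using elim resolvent by (simp add: A_def)
      have le: "norm (ainv (1 - s *\<^sub>C b)) \<le> 2 * K"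
        unfolding eq K_def using elim by (intro perturb_invertible inv) (simp add: K_def)
      have "pow_inv 0 s - pow_inv 0 t =
          ainv (1 - s *\<^sub>C b) * ((s - t) *\<^sub>C b) * ainv (1 - t *\<^sub>C b)"
        using ainv_diff[OF inv' inv] by (simp add: pow_inv_def scaleC.diff_left)
      also have "norm \<dots> \<le> norm (ainv (1 - s *\<^sub>C b)) * norm ((s - t) *\<^sub>C b) * K"
        unfolding K_def
        by (meson norm_mult_ineq mult_right_mono norm_ge_zero order_trans)
      also have "\<dots> \<le> 2 * K * norm ((s - t) *\<^sub>C b) * K"
        using le by (intro mult_right_mono) (auto simp: K_def)
      finally show ?case by (simp add: mult.assoc)
    qed
    from Lim_null_comparison[OF this tendsto_mult_right_zero[OF lim]]
    show "(pow_inv 0 \<longlongrightarrow> pow_inv 0 t) (at t within A)" by (rule LIM_zero_cancel)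
  qed
  have "bounded (pow_inv 0 ` A)"
    using compact_continuous_image[OF cont \<open>compact A\<close>] by (rule compact_imp_bounded)
  then obtain M where "0 < M" "\<forall>x\<in>pow_inv 0 ` A. norm x \<le> M" unfolding bounded_pos by blast
  with that[of M] show ?thesis by (auto simp: A_def)
qed

text \<open>Each \<open>pow_inv (Suc m) t\<close> averages \<open>pow_inv m\<close> over two points
  of modulus \<open>norm t\<close>, so bounds at \<open>m = 0\<close> persist with the same
  constant. The Lipschitz estimate uses a factor \<open>w\<close> rather than a difference because
  multiplication by \<open>w\<close> commutes with the rotations.\<close>

lemma pow_inv_bounded_lipschitz:
  obtains L where "0 < L"
    "\<And>m t. t0 \<le> norm t \<Longrightarrow> norm t \<le> t1 \<Longrightarrow> norm (pow_inv m t) \<le> L"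
    "\<And>m t w. t0 \<le> norm t \<Longrightarrow> norm t \<le> t1 \<Longrightarrow> t0 \<le> norm (w * t) \<Longrightarrow> norm (w * t) \<le> t1 \<Longrightarrow>
      norm (pow_inv m (w * t) - pow_inv m t) \<le> L * norm (w - 1)"
proof -
  obtain M where M: "0 < M" "\<And>t. t0 \<le> norm t \<Longrightarrow> norm t \<le> t1 \<Longrightarrow> norm (pow_inv 0 t) \<le> M"
    using pow_inv_0_bounded[of t1] by blast
  \<comment> \<open>The second summand is the Lipschitz constant that \<open>ainv_diff\<close> gives
    at \<open>m = 0\<close>; adding \<open>M\<close> lets one constant serve both estimates.\<close>
  define L where "L = M + M * (\<bar>t1\<bar> * norm b) * M"
  have L: "0 < L" "M \<le> L" "M * (\<bar>t1\<bar> * norm b) * M \<le> L" using M(1) by (auto simp: L_def add_pos_nonneg)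
  have bd: "norm (pow_inv m t) \<le> M" if "t0 \<le> norm t" "norm t \<le> t1" for m t
    using that
  proof (induction m arbitrary: t)
    case 0
    then show ?case using M by blast
  next
    case (Suc m)
    have "norm (pow_inv (Suc m) t)
        \<le> (norm (pow_inv m t) + norm (pow_inv m (cis (pi / 2 ^ m) * t))) / 2"
      using norm_triangle_ineq[of "pow_inv m t" "pow_inv m (cis (pi / 2 ^ m) * t)"]
      by (simp add: pow_inv_Suc Suc.prems)
    also have "\<dots> \<le> (M + M) / 2"
      using Suc by (intro divide_right_mono add_mono Suc.IH) (auto simp: norm_mult)
    finally show ?case by simp
  qed
  have lip: "norm (pow_inv m (w * t) - pow_inv m t) \<le> L * norm (w - 1)"
    if "t0 \<le> norm t" "norm t \<le> t1" "t0 \<le> norm (w * t)" "norm (w * t) \<le> t1" for m t w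
    using that
  proof (induction m arbitrary: t)
    case 0
    have "pow_inv 0 (w * t) - pow_inv 0 t =
        pow_inv 0 (w * t) * (((w - 1) * t) *\<^sub>C b) * pow_inv 0 t"
      using ainv_diff[OF resolvent[of "w * t"] resolvent[of t]] 0
      by (simp add: pow_inv_def scaleC.diff_left left_diff_distrib)
    also have "norm \<dots> \<le> norm (pow_inv 0 (w * t)) * norm (((w - 1) * t) *\<^sub>C b) * norm (pow_inv 0 t)"
      by (meson norm_mult_ineq mult_right_mono norm_ge_zero order_trans)
    also have "\<dots> \<le> M * (norm (w - 1) * \<bar>t1\<bar> * norm b) * M"
      using 0 M(1) by (intro mult_mono bd) (auto simp: norm_scaleC norm_mult intro!: mult_mono)
    also have "\<dots> = (M * (\<bar>t1\<bar> * norm b) * M) * norm (w - 1)" by simp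
    also have "\<dots> \<le> L * norm (w - 1)" using L(3) by (intro mult_right_mono) auto
    finally show ?case .
  next
    case (Suc m)
    let ?e = "cis (pi / 2 ^ m)"
    have "pow_inv (Suc m) (w * t) - pow_inv (Suc m) t = (1 / 2) *\<^sub>R
       ((pow_inv m (w * t) - pow_inv m t) + (pow_inv m (w * (?e * t)) - pow_inv m (?e * t)))"
      using Suc.prems by (simp add: pow_inv_Suc algebra_simps)
    also have "norm \<dots> \<le> (norm (pow_inv m (w * t) - pow_inv m t)
        + norm (pow_inv m (w * (?e * t)) - pow_inv m (?e * t))) / 2"
      by (simp add: norm_triangle_ineq)
    also have "\<dots> \<le> (L * norm (w - 1) + L * norm (w - 1)) / 2"
      using Suc.prems by (intro divide_right_mono add_mono Suc.IH) (auto simp: norm_mult)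
    finally show ?case by simp
  qed
  show ?thesis using that[OF L(1) order_trans[OF bd L(2)] lip] by blast
qed

section \<open>The limit of the Riemann sums is an idempotent independent of the radius\<close>

definition riesz_idem :: "real \<Rightarrow> 'a" where
  "riesz_idem t = lim (\<lambda>m. pow_inv m t)"

text \<open>Passing from \<open>m\<close> to \<open>Suc m\<close> changes the value by half the
  effect of a rotation through the angle \<open>pi / 2 ^ m\<close>, so the increments are dominated
  by a geometric series.\<close>

lemma pow_inv_tendsto:
  assumes "t0 \<le> t" shows "(\<lambda>m. pow_inv m t) \<longlonglongrightarrow> riesz_idem t"
proof -
  obtain L where L: "0 < L" "\<And>m s w. t0 \<le> norm s \<Longrightarrow> norm s \<le> t \<Longrightarrow> t0 \<le> norm (w * s) \<Longrightarrow>
      norm (w * s) \<le> t \<Longrightarrow> norm (pow_inv m (w * s) - pow_inv m s) \<le> L * norm (w - 1)"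
    using pow_inv_bounded_lipschitz[of t] by metis
  have le: "norm (pow_inv (Suc m) t - pow_inv m t) \<le> L * pi * (1 / 2) ^ m" for m
  proof -
    let ?e = "cis (pi / 2 ^ m)"
    have "pow_inv (Suc m) t - pow_inv m t = (1 / 2) *\<^sub>R (pow_inv m (?e * t) - pow_inv m t)"
      using assms t0_pos scaleR_half_double[of "pow_inv m t"]
      by (simp add: pow_inv_Suc scaleR_diff_right scaleR_add_right)
         (simp add: algebra_simps flip: scaleR_add_left)
    also have "norm \<dots> = norm (pow_inv m (?e * t) - pow_inv m t) / 2" by simp
    also have "\<dots> \<le> norm (pow_inv m (?e * t) - pow_inv m t)" by simp
    also have "\<dots> \<le> L * norm (?e - 1)"
      using L(2)[of t ?e m] assms t0_pos by (simp add: norm_mult)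
    also have "\<dots> \<le> L * (pi / 2 ^ m)"
      using norm_cis_minus_one_le[of "pi / 2 ^ m"] L(1) by (intro mult_left_mono) auto
    finally show ?thesis by (simp add: power_divide)
  qed
  have "summable (\<lambda>m. pow_inv (Suc m) t - pow_inv m t)"
    by (rule summable_comparison_test'[OF summable_mult[OF summable_geometric[of "1 / 2"]] le]) simp
  from summable_LIMSEQ[OF this]
  have "(\<lambda>n. pow_inv n t - pow_inv 0 t) \<longlonglongrightarrow> (\<Sum>m. pow_inv (Suc m) t - pow_inv m t)"
    by (simp add: sum_lessThan_telescope[of "\<lambda>m. pow_inv m (complex_of_real t)"])
  from tendsto_add[OF this tendsto_const[of "pow_inv 0 t"]]
  show ?thesis unfolding riesz_idem_def by (simp add: limI)
qed

lemma pow_inv_commute: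
  assumes "x * b = b * x" "t0 \<le> t"
  shows "x * pow_inv m t = pow_inv m t * x"
proof -
  have "x * b ^ n = b ^ n * x" for n
    using power_commuting_commutes[of b x n] assms(1) by simp
  then show ?thesis unfolding pow_inv_def using assms(2) t0_pos
    by (intro commute_ainv pow_invertible) (simp_all add: algebra_simps scaleC_power scaleC_assoc)
qed

lemma riesz_idem_commute:
  assumes "x * b = b * x" "t0 \<le> t"
  shows "x * riesz_idem t = riesz_idem t * x"
proof (rule LIMSEQ_unique)
  show "(\<lambda>m. x * pow_inv m t) \<longlonglongrightarrow> x * riesz_idem t"
    by (intro tendsto_mult tendsto_const pow_inv_tendsto assms)
  have "(\<lambda>m. pow_inv m t * x) \<longlonglongrightarrow> riesz_idem t * x"
    by (intro tendsto_mult tendsto_const pow_inv_tendsto assms)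
  then show "(\<lambda>m. x * pow_inv m t) \<longlonglongrightarrow> riesz_idem t * x" by (simp add: pow_inv_commute assms)
qed

text \<open>With \<open>X\<close> and \<open>Y\<close> the elements inverted at \<open>t\<close> and
  \<open>s\<close>, and \<open>k m\<close> the \<open>2 ^ m\<close>-th power of
  \<open>s / t\<close>, one has \<open>(1 - k m) *\<^sub>R 1 = Y - k m *\<^sub>R X\<close>.
  Multiplying by both inverses and letting \<open>k m\<close> tend to 0, which uses
  \<open>s < t\<close>, gives the product.\<close>

lemma riesz_idem_mult:
  assumes "t0 \<le> s" "s < t"
  shows "riesz_idem t * riesz_idem s = riesz_idem t"
proof -
  define k where "k m = (s / t) ^ (2 ^ m)" for m :: nat
  have k: "k \<longlonglongrightarrow> 0"
    unfolding k_def using assms t0_pos by (intro power_two_power_null) auto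
  have eq: "(1 - k m) *\<^sub>R (pow_inv m t * pow_inv m s) = pow_inv m t - k m *\<^sub>R pow_inv m s" for m
  proof -
    define X where "X = 1 - (complex_of_real t *\<^sub>C b) ^ (2 ^ m)"
    define Y where "Y = 1 - (complex_of_real s *\<^sub>C b) ^ (2 ^ m)"
    have X: "X \<in> invertible_elems" "Y \<in> invertible_elems"
      unfolding X_def Y_def using assms t0_pos by (auto intro!: pow_invertible)
    have "s ^ (2 ^ m) = k m * t ^ (2 ^ m)" using assms t0_pos by (simp add: k_def power_divide)
    then have "(complex_of_real s *\<^sub>C b) ^ (2 ^ m) = k m *\<^sub>R (complex_of_real t *\<^sub>C b) ^ (2 ^ m)"
      by (simp add: scaleC_power scaleR_scaleC scaleC_scaleC flip: of_real_power of_real_mult)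
    then have "(1 - k m) *\<^sub>R 1 = Y - k m *\<^sub>R X"
      by (simp add: X_def Y_def algebra_simps)
    then have "ainv X * ((1 - k m) *\<^sub>R 1) * ainv Y = ainv X * (Y - k m *\<^sub>R X) * ainv Y" by simp
    then show ?thesis
      by (simp add: pow_inv_def X_def[symmetric] Y_def[symmetric])
        (simp add: algebra_simps ainv X ainv_cancel)
  qed
  have "(\<lambda>m. (1 - k m) *\<^sub>R (pow_inv m t * pow_inv m s)) \<longlonglongrightarrow> (1 - 0) *\<^sub>R (riesz_idem t * riesz_idem s)"
    using assms by (intro tendsto_intros k pow_inv_tendsto) auto
  moreover have "(\<lambda>m. pow_inv m t - k m *\<^sub>R pow_inv m s) \<longlonglongrightarrow> riesz_idem t - 0 *\<^sub>R riesz_idem s"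
    using assms by (intro tendsto_intros k pow_inv_tendsto) auto
  ultimately show ?thesis unfolding eq using LIMSEQ_unique by fastforce
qed

lemma riesz_idem_lipschitz:
  obtains K where "0 < K"
    "\<And>s t. t0 \<le> s \<Longrightarrow> s \<le> t1 \<Longrightarrow> t0 \<le> t \<Longrightarrow> t \<le> t1 \<Longrightarrow>
      norm (riesz_idem t - riesz_idem s) \<le> K * \<bar>t - s\<bar>"
proof -
  obtain L where L: "0 < L" "\<And>m s w. t0 \<le> norm s \<Longrightarrow> norm s \<le> t1 \<Longrightarrow> t0 \<le> norm (w * s) \<Longrightarrow>
      norm (w * s) \<le> t1 \<Longrightarrow> norm (pow_inv m (w * s) - pow_inv m s) \<le> L * norm (w - 1)"
    using pow_inv_bounded_lipschitz[of t1] by metis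
  have "norm (riesz_idem t - riesz_idem s) \<le> L / t0 * \<bar>t - s\<bar>"
    if st: "t0 \<le> s" "s \<le> t1" "t0 \<le> t" "t \<le> t1" for s t
  proof (rule LIMSEQ_le_const2)
    show "(\<lambda>m. norm (pow_inv m t - pow_inv m s)) \<longlonglongrightarrow> norm (riesz_idem t - riesz_idem s)"
      using st by (intro tendsto_intros pow_inv_tendsto) auto
    have "norm (pow_inv m t - pow_inv m s) \<le> L / t0 * \<bar>t - s\<bar>" for m
    proof -
      have "norm (pow_inv m t - pow_inv m s) \<le> L * norm (complex_of_real (t / s) - 1)"
        using L(2)[of s "complex_of_real (t / s)" m] st t0_pos by simp
      also have "norm (complex_of_real (t / s) - 1) = \<bar>t - s\<bar> / s"
      proof -
        have "complex_of_real (t / s) - 1 = of_real ((t - s) / s)"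
          using st t0_pos by (simp add: field_simps)
        then show ?thesis using st t0_pos by (simp only: norm_of_real abs_divide)
      qed
      also have "\<dots> \<le> \<bar>t - s\<bar> / t0" using st t0_pos by (intro divide_left_mono) auto
      finally show ?thesis using L(1) by simp
    qed
    then show "\<exists>N. \<forall>m\<ge>N. norm (pow_inv m t - pow_inv m s) \<le> L / t0 * \<bar>t - s\<bar>" by blast
  qed
  moreover have "0 < L / t0" using L(1) t0_pos by simp
  ultimately show ?thesis using that by blast
qed

text \<open>\<open>riesz_idem_mult\<close> requires distinct parameters, so idempotence is obtained
  by letting a larger parameter decrease to \<open>s\<close>, using Lipschitz continuity.\<close>

lemma riesz_idem_idem:
  assumes "t0 \<le> s" shows "riesz_idem s * riesz_idem s = riesz_idem s"
proof -
  obtain K where K: "0 < K" "\<And>t. s \<le> t \<Longrightarrow> t \<le> s + 1 \<Longrightarrow>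
      norm (riesz_idem t - riesz_idem s) \<le> K * \<bar>t - s\<bar>"
    using riesz_idem_lipschitz[of "s + 1"] assms by (metis order_trans le_add_same_cancel1 zero_le_one)
  define u where "u n = s + inverse (real (Suc n))" for n
  have "norm (riesz_idem (u n) - riesz_idem s) \<le> K * inverse (real (Suc n))" for n
    using K(2)[of "u n"] by (simp add: u_def field_simps)
  then have "\<forall>\<^sub>F n in sequentially. norm (riesz_idem (u n) - riesz_idem s) \<le> K * inverse (real (Suc n))"
    by simp
  from Lim_null_comparison[OF this tendsto_mult_right_zero[OF LIMSEQ_inverse_real_of_nat]]
  have lim: "(\<lambda>n. riesz_idem (u n)) \<longlonglongrightarrow> riesz_idem s" by (rule LIM_zero_cancel)
  have "riesz_idem (u n) * riesz_idem s = riesz_idem (u n)" for n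
    using assms by (intro riesz_idem_mult) (simp_all add: u_def)
  with tendsto_mult[OF lim tendsto_const[of "riesz_idem s"]] lim show ?thesis
    using LIMSEQ_unique by fastforce
qed

text \<open>By \<open>riesz_idem_mult\<close> the difference of two of these idempotents is again
  idempotent, and a nonzero idempotent has norm at least 1. Lipschitz continuity therefore makes
  \<open>riesz_idem\<close> locally constant, hence constant on the connected interval.\<close>

lemma riesz_idem_const:
  assumes "t0 \<le> s" "s \<le> t"
  shows "riesz_idem s = riesz_idem t"
proof -
  obtain K where K: "0 < K" "\<And>x y. t0 \<le> x \<Longrightarrow> x \<le> t \<Longrightarrow> t0 \<le> y \<Longrightarrow> y \<le> t \<Longrightarrow>
      norm (riesz_idem y - riesz_idem x) \<le> K * \<bar>y - x\<bar>"
    using riesz_idem_lipschitz[of t] by metis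
  have eq: "riesz_idem x = riesz_idem y" if xy: "t0 \<le> x" "x < y" "y \<le> t" "K * (y - x) < 1" for x y
  proof -
    define e where "e = riesz_idem x - riesz_idem y"
    have "riesz_idem x * riesz_idem y = riesz_idem y * riesz_idem x"
      using xy by (intro riesz_idem_commute riesz_idem_commute[symmetric]) auto
    then have "e * e = e"
      using xy by (simp add: e_def algebra_simps riesz_idem_idem riesz_idem_mult)
    then have "norm e \<le> norm e * norm e" by (metis norm_mult_ineq)
    moreover have "norm e < 1"
      using K(2)[of y x] xy by (simp add: e_def)
    ultimately have "norm e = 0"
      using mult_strict_left_mono[of "norm e" 1 "norm e"] by fastforce
    then show ?thesis by (simp add: e_def)
  qed
  show ?thesis
  proof (rule connected_local_const[of "{t0..t}"])
    show "\<forall>x\<in>{t0..t}. \<forall>\<^sub>F y in at x within {t0..t}. riesz_idem x = riesz_idem y"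
    proof
      fix x assume x: "x \<in> {t0..t}"
      have "riesz_idem x = riesz_idem y" if "y \<in> {t0..t}" "dist y x < 1 / K" for y
      proof -
        have "K * \<bar>y - x\<bar> < 1" using that(2) K(1) by (simp add: dist_real_def pos_less_divide_eq mult.commute)
        then show ?thesis
        proof (cases x y rule: linorder_cases)
          case less
          then show ?thesis using \<open>K * \<bar>y - x\<bar> < 1\<close> that(1) x by (intro eq) auto
        next
          case greater
          then show ?thesis using \<open>K * \<bar>y - x\<bar> < 1\<close> that(1) x by (intro eq[symmetric]) auto
        qed simp
      qed
      then show "\<forall>\<^sub>F y in at x within {t0..t}. riesz_idem x = riesz_idem y"
        unfolding eventually_at using K(1) by (intro exI[of _ "1 / K"]) auto
    qed
  qed (use assms in auto)
qed

end

text \<open>For an idempotent \<open>p\<close> commuting with \<open>b\<close> this says that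
  \<open>b * p\<close> has spectral radius 0, since then \<open>(b * p) ^ N = b ^ N * p\<close>. One
  exponent for each \<open>\<rho>\<close> is enough, because the spectral radius is an
  infimum.\<close>

definition locally_quasinilpotent :: "'a::real_normed_algebra_1 \<Rightarrow> 'a \<Rightarrow> bool" where
  "locally_quasinilpotent b p \<longleftrightarrow> (\<forall>\<rho>>0. \<exists>N\<ge>1. norm (b ^ N * p) < \<rho> ^ N)"

lemma locally_quasinilpotentD:
  assumes "locally_quasinilpotent b p" "0 < \<rho>"
  obtains N where "1 \<le> N" "norm (b ^ N * p) < \<rho> ^ N"
  using assms unfolding locally_quasinilpotent_def by blast

lemma locally_quasinilpotent_vanish:
  assumes "locally_quasinilpotent b p"
    and "0 \<le> K" "\<And>N. 1 \<le> N \<Longrightarrow> norm x \<le> C * (K ^ N * norm (b ^ N * p))"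
  shows "x = 0"
proof (rule ccontr)
  assume "x \<noteq> 0"
  define D where "D = \<bar>C\<bar> + 1"
  \<comment> \<open>The cap at 1 gives \<open>\<epsilon> ^ N \<le> \<epsilon>\<close>. The decay is
    then applied with \<open>\<epsilon> / (K + 1)\<close>, where the added 1 keeps the quotient
    defined for \<open>K = 0\<close>.\<close>
  define \<epsilon> where "\<epsilon> = min 1 (norm x / D)"
  have D: "D > 0" "C \<le> D" by (auto simp: D_def)
  have \<epsilon>: "0 < \<epsilon>" "\<epsilon> \<le> 1" "D * \<epsilon> \<le> norm x"
    using \<open>x \<noteq> 0\<close> D by (auto simp: \<epsilon>_def min_def field_simps)
  have "0 < \<epsilon> / (K + 1)" using \<epsilon> assms(2) by simp
  then obtain N where N: "1 \<le> N" "norm (b ^ N * p) < (\<epsilon> / (K + 1)) ^ N"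
    using locally_quasinilpotentD[OF assms(1)] by metis
  have "norm x \<le> D * (K ^ N * norm (b ^ N * p))"
    using assms(3)[OF N(1)] mult_right_mono[OF D(2), of "K ^ N * norm (b ^ N * p)"] assms(2) by simp
  also have "\<dots> \<le> D * ((K + 1) ^ N * norm (b ^ N * p))"
    using assms(2) D by (intro mult_left_mono mult_right_mono power_mono) auto
  also have "\<dots> < D * ((K + 1) ^ N * (\<epsilon> / (K + 1)) ^ N)"
    using assms(2) D N by (intro mult_strict_left_mono) auto
  also have "\<dots> = D * \<epsilon> ^ N" using assms(2) by (simp add: power_divide)
  also have "\<dots> \<le> D * \<epsilon>"
    using \<epsilon> D power_decreasing[OF N(1), of \<epsilon>] by simp
  finally show False using \<epsilon>(3) by simp
qed

lemma idem_mult_power: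
  fixes b p :: "'a::ring_1"
  assumes "p * p = p" "b * p = p * b" "1 \<le> N"
  shows "(b * p) ^ N = b ^ N * p"
  using assms(3)
proof (induction N rule: dec_induct)
  case (step n)
  have "p * b ^ n = b ^ n * p" using power_commuting_commutes[of b p n] assms(2) by simp
  have "(b * p) ^ Suc n = b * (p * b ^ n) * p" using step by (simp add: mult.assoc)
  also have "\<dots> = b ^ Suc n * p"
    by (simp only: \<open>p * b ^ n = b ^ n * p\<close>) (simp add: mult.assoc assms(1))
  finally show ?case .
qed simp

text \<open>Decay at the rate \<open>1 / (norm z + 1)\<close> makes some power of
  \<open>z *\<^sub>C x\<close> have norm below 1. Only powers of \<open>x\<close> are compared with
  those of \<open>b\<close> on \<open>p\<close>, so that the result also applies to compressions of
  \<open>b\<close>.\<close>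

lemma invertible_one_minus_power_le:
  fixes b p x :: "'a::complex_banach_algebra_1"
  assumes "locally_quasinilpotent b p" "\<And>N. 1 \<le> N \<Longrightarrow> norm (x ^ N) \<le> norm (b ^ N * p)"
  shows "1 - z *\<^sub>C x \<in> invertible_elems"
proof -
  have "0 < 1 / (norm z + 1)" by (simp add: add_nonneg_pos)
  then obtain N where N: "1 \<le> N" "norm (b ^ N * p) < (1 / (norm z + 1)) ^ N"
    using locally_quasinilpotentD[OF assms(1)] by metis
  have "norm ((z *\<^sub>C x) ^ N) = norm z ^ N * norm (x ^ N)"
    by (simp add: scaleC_power norm_scaleC norm_power)
  also have "\<dots> \<le> (norm z + 1) ^ N * norm (b ^ N * p)"
    using assms(2)[OF N(1)] by (intro mult_mono power_mono) auto
  also have "\<dots> < (norm z + 1) ^ N * (1 / (norm z + 1)) ^ N"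
    using N by (intro mult_strict_left_mono zero_less_power) (auto simp: add_nonneg_pos)
  also have "\<dots> = 1" by (simp add: power_mult_distrib[symmetric] add_nonneg_eq_0_iff)
  finally show ?thesis by (rule neumann_power)
qed

lemma invertible_one_minus_locally_quasinilpotent:
  fixes b p :: "'a::complex_banach_algebra_1"
  assumes "p * p = p" "b * p = p * b" "locally_quasinilpotent b p"
  shows "1 - z *\<^sub>C (b * p) \<in> invertible_elems"
  by (intro invertible_one_minus_power_le[OF assms(3)]) (simp add: idem_mult_power[OF assms(1,2)])

lemma ainv_power_mult:
  fixes b :: "'a::monoid_mult"
  assumes "b \<in> invertible_elems"
  shows "ainv b ^ n * b ^ n = 1"
proof (induction n)
  case (Suc n)
  have "ainv b ^ Suc n * b ^ Suc n = ainv b ^ n * (ainv b * (b * b ^ n))"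
    by (simp add: power_Suc2 mult.assoc del: power_Suc) (simp add: power_commutes)
  then show ?case using Suc by (simp add: ainv_cancel assms)
qed simp

section \<open>The Riesz idempotent splits \<open>b\<close> into a quasinilpotent and an invertible
  part\<close>

context punctured_resolvent
begin

lemma pow_inv_right: "t0 \<le> t \<Longrightarrow> (1 - (complex_of_real t *\<^sub>C b) ^ (2 ^ m)) * pow_inv m t = 1"
  unfolding pow_inv_def using t0_pos by (intro ainv pow_invertible) simp

text \<open>With \<open>X\<close> the power of \<open>t *\<^sub>C b\<close> and
  \<open>R = pow_inv m t\<close>, the identity \<open>X * R = R - 1\<close> gives
  \<open>X * R * p = R * p - p\<close>, which tends to \<open>p * p - p = 0\<close>. It remains to
  cancel the factor \<open>R\<close> on the range of \<open>p\<close>.\<close>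

lemma riesz_idem_power_null:
  assumes "t0 \<le> t" and p: "p = riesz_idem t"
  shows "(\<lambda>m. (complex_of_real t *\<^sub>C b) ^ (2 ^ m) * p) \<longlonglongrightarrow> 0"
proof -
  define X where "X m = (complex_of_real t *\<^sub>C b) ^ (2 ^ m)" for m :: nat
  \<comment> \<open>Adding \<open>1 - p\<close> makes \<open>Q m\<close> tend to 1, so that
    multiplication by \<open>Q m\<close> can be undone in norm.\<close>
  define Q where "Q m = pow_inv m t * p + (1 - p)" for m
  have pp: "p * p = p" using assms riesz_idem_idem by simp
  have bp: "b * p = p * b" using assms riesz_idem_commute by simp
  have pq: "p * pow_inv m t = pow_inv m t * p" for m
    using bp assms by (intro pow_inv_commute) simp_all
  have lim: "(\<lambda>m. pow_inv m t) \<longlonglongrightarrow> p" using pow_inv_tendsto assms by simp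
  have XpQ: "X m * p * Q m = pow_inv m t * p - p" for m
  proof -
    have "X m * pow_inv m t = pow_inv m t - 1"
      using pow_inv_right[OF assms(1), of m] by (simp add: X_def algebra_simps)
    then have "X m * pow_inv m t * p = (pow_inv m t - 1) * p" by simp
    then have *: "X m * (pow_inv m t * p) = pow_inv m t * p - p" by (simp add: algebra_simps)
    have "X m * p * Q m = X m * (p * pow_inv m t * p)"
      by (simp add: Q_def algebra_simps pp)
    also have "p * pow_inv m t * p = pow_inv m t * p" by (simp add: pq mult.assoc pp)
    finally show ?thesis by (simp only: *)
  qed
  have "(\<lambda>m. 1 - Q m) \<longlonglongrightarrow> 1 - (p * p + (1 - p))"
    unfolding Q_def by (intro tendsto_intros lim)
  then have "(\<lambda>m. 1 - Q m) \<longlonglongrightarrow> 0" by (simp add: pp)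
  from order_tendstoD(2)[OF tendsto_norm_zero[OF this], of "1 / 2"]
  have "\<forall>\<^sub>F m in sequentially. norm (1 - Q m) < 1 / 2" by simp
  then have "\<forall>\<^sub>F m in sequentially. norm (X m * p) \<le> 2 * norm (X m * p * Q m)"
  proof eventually_elim
    case (elim m)
    have "norm (X m * p) \<le> norm (X m * p * (1 - Q m)) + norm (X m * p * Q m)"
      using norm_triangle_ineq[of "X m * p * (1 - Q m)" "X m * p * Q m"] by (simp add: algebra_simps)
    also have "norm (X m * p * (1 - Q m)) \<le> norm (X m * p) * norm (1 - Q m)" by (rule norm_mult_ineq)
    also have "\<dots> \<le> norm (X m * p) * (1 / 2)" using elim by (intro mult_left_mono) auto
    finally show ?case by simp
  qed
  moreover have "(\<lambda>m. 2 * norm (X m * p * Q m)) \<longlonglongrightarrow> 0"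
  proof -
    have "(\<lambda>m. 2 * norm (X m * p * Q m)) \<longlonglongrightarrow> 2 * norm (p * p - p)"
      unfolding XpQ by (intro tendsto_intros lim)
    then show ?thesis by (simp add: pp)
  qed
  ultimately show ?thesis unfolding X_def[symmetric] by (rule Lim_null_comparison)
qed

lemma riesz_idem_locally_quasinilpotent: "locally_quasinilpotent b (riesz_idem t0)"
  unfolding locally_quasinilpotent_def
proof (intro allI impI)
  fix \<rho> :: real assume "0 < \<rho>"
  \<comment> \<open>As the idempotent is the same for every parameter, \<open>t\<close> may be taken
    so large that \<open>1 / t \<le> \<rho>\<close>.\<close>
  define t where "t = max t0 (1 / \<rho>)"
  have t: "t0 \<le> t" "1 / \<rho> \<le> t" "0 < t" using t0_pos by (auto simp: t_def)
  let ?p = "riesz_idem t0"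
  have p: "?p = riesz_idem t" using riesz_idem_const t by simp
  have "\<forall>\<^sub>F m in sequentially. norm ((complex_of_real t *\<^sub>C b) ^ (2 ^ m) * ?p) < 1"
    using order_tendstoD(2)[OF tendsto_norm_zero[OF riesz_idem_power_null[OF t(1) p]], of 1] by simp
  then obtain m where m: "norm ((complex_of_real t *\<^sub>C b) ^ (2 ^ m) * ?p) < 1"
    using eventually_happens by fastforce
  then have "t ^ (2 ^ m) * norm (b ^ (2 ^ m) * ?p) < 1"
    using t by (simp add: scaleC_power mult_scaleC_left norm_scaleC norm_power)
  then have "norm (b ^ (2 ^ m) * ?p) < (1 / t) ^ (2 ^ m)"
    using t by (simp add: power_divide field_simps)
  also have "\<dots> \<le> \<rho> ^ (2 ^ m)"
    using t \<open>0 < \<rho>\<close> by (intro power_mono) (auto simp: field_simps)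
  finally show "\<exists>N\<ge>1. norm (b ^ N * ?p) < \<rho> ^ N" by (intro exI[of _ "2 ^ m"]) simp
qed

text \<open>\<open>b + p\<close> factors as \<open>(b * (1 - p) + p) * (1 + b * p)\<close>. The
  second factor is invertible by quasinilpotence. For the first, the commuting element
  \<open>y * (1 - p) + p\<close> gives a product \<open>1 - q * (1 - p)\<close> close to 1, because
  \<open>q\<close> is close to \<open>p\<close>.\<close>

lemma invertible_add_riesz_idem: "b + riesz_idem t0 \<in> invertible_elems"
proof -
  define p where "p = riesz_idem t0"
  have pp: "p * p = p" using riesz_idem_idem by (simp add: p_def)
  have bp: "b * p = p * b" using riesz_idem_commute by (simp add: p_def)
  have lim: "(\<lambda>m. pow_inv m t0) \<longlonglongrightarrow> p" using pow_inv_tendsto by (simp add: p_def)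
  have "(\<lambda>m. pow_inv m t0 * (1 - p)) \<longlonglongrightarrow> p * (1 - p)" by (intro tendsto_intros lim)
  then have "(\<lambda>m. pow_inv m t0 * (1 - p)) \<longlonglongrightarrow> 0" by (simp add: algebra_simps pp)
  from order_tendstoD(2)[OF tendsto_norm_zero[OF this], of 1]
  obtain m where m: "norm (pow_inv m t0 * (1 - p)) < 1"
    using eventually_happens by fastforce
  define q where "q = pow_inv m t0"
  define n :: nat where "n = 2 ^ m - 1"
  have n: "2 ^ m = Suc n" by (simp add: n_def)
  \<comment> \<open>One factor \<open>b\<close> is split off the \<open>2 ^ m\<close>-th power in
    \<open>pow_inv_right\<close>; what remains is chosen so that
    \<open>b * y = 1 - q\<close>.\<close>
  define y where "y = - (complex_of_real t0 ^ Suc n *\<^sub>C (b ^ n * q))"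
  have pq: "p * q = q * p" and bq: "b * q = q * b"
    unfolding q_def using bp by (simp_all add: pow_inv_commute)
  have "q - (complex_of_real t0 *\<^sub>C b) ^ 2 ^ m * q = 1"
    using pow_inv_right[of t0 m] by (simp add: q_def algebra_simps)
  moreover have "b * y = - ((complex_of_real t0 *\<^sub>C b) ^ 2 ^ m * q)"
    unfolding n scaleC_power y_def by (simp add: mult_scaleC_left mult_scaleC_right mult.assoc)
  ultimately have "b * y = 1 - q" by (simp add: algebra_simps)
  have comm: "b ^ n * q * x = x * (b ^ n * q)" if "b * x = x * b" "x * q = q * x" for x
    using power_commuting_commutes[OF that(1), of n] that(2)[symmetric] by (metis mult.assoc)
  have yb: "y * b = b * y" and yp: "y * p = p * y"
    using comm[of b] comm[of p] bq bp pq
    by (simp_all add: y_def mult_scaleC_left mult_scaleC_right)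
  have yp': "y * (p * x) = p * (y * x)" "b * (p * x) = p * (b * x)" "p * (p * x) = p * x"
    "q * (p * x) = p * (q * x)" "y * (b * x) = b * (y * x)" for x
    by (metis yp bp pq pp yb mult.assoc)+
  have "(b * (1 - p) + p) * (y * (1 - p) + p) = (b * y) * (1 - p) + p"
    by (simp add: algebra_simps yp yp' bp pp)
  also have "\<dots> = 1 - q * (1 - p)" by (simp add: \<open>b * y = 1 - q\<close> algebra_simps)
  also have "\<dots> \<in> invertible_elems" using m by (intro neumann) (simp add: q_def)
  finally have "(b * (1 - p) + p) * (y * (1 - p) + p) \<in> invertible_elems" .
  moreover have "(b * (1 - p) + p) * (y * (1 - p) + p) = (y * (1 - p) + p) * (b * (1 - p) + p)"
    by (simp add: algebra_simps yp yp' bp pp yb)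
  ultimately have "b * (1 - p) + p \<in> invertible_elems" using invertible_factor by blast
  moreover have "1 + b * p \<in> invertible_elems"
    using invertible_one_minus_locally_quasinilpotent[OF pp bp, of "-1"]
      riesz_idem_locally_quasinilpotent by (simp add: p_def scaleC.minus_left)
  moreover have "(b * (1 - p) + p) * (1 + b * p) = b + p"
    by (simp add: algebra_simps yp' bp pp)
  ultimately show ?thesis using invertible_mult p_def by metis
qed

end

lemma invertible_one_minus_scaleC:
  fixes b :: "'a::complex_banach_algebra_1"
  assumes "t \<noteq> 0" "1 / t \<notin> alg_spectrum b"
  shows "1 - t *\<^sub>C b \<in> invertible_elems"
proof -
  have "t *\<^sub>C ((1 / t) *\<^sub>C 1 - b) \<in> invertible_elems"
    using assms invertible_scaleC by (auto simp: alg_spectrum_def)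
  then show ?thesis using assms(1) by (simp add: scaleC.diff_right scaleC_scaleC)
qed

text \<open>The choice \<open>t0 = 1 / r\<close> covers all circles around 0 of radius at most
  \<open>r\<close>. Invertibility of \<open>b + p\<close> records that \<open>b\<close> is
  invertible on the complement of \<open>p\<close>.\<close>

theorem spectral_idempotent:
  fixes b :: "'a::complex_banach_algebra_1"
  assumes "0 < r" "\<And>z. z \<noteq> 0 \<Longrightarrow> norm z \<le> r \<Longrightarrow> z \<notin> alg_spectrum b"
  obtains p where "p * p = p" "\<And>x. x * b = b * x \<Longrightarrow> x * p = p * x"
    "locally_quasinilpotent b p" "b + p \<in> invertible_elems"
proof -
  interpret punctured_resolvent b "1 / r"
  proof
    fix t :: complex assume t: "1 / r \<le> norm t"
    then have "t \<noteq> 0" using assms(1) by auto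
    then show "1 - t *\<^sub>C b \<in> invertible_elems"
      using t assms(1) by (intro invertible_one_minus_scaleC assms(2)) (auto simp: norm_divide field_simps)
  qed (use assms in simp)
  show ?thesis
    using that[of "riesz_idem (1 / r)"] riesz_idem_idem riesz_idem_commute
      riesz_idem_locally_quasinilpotent invertible_add_riesz_idem by blast
qed

text \<open>With empty spectrum every circle is admissible. On a large circle (small
  \<open>t\<close>) the Riemann sums tend to 1; on a small one (large \<open>t\<close>) they tend to
  0, as \<open>b\<close> is then invertible. This contradicts independence of the radius.\<close>

theorem spectrum_nonempty: "alg_spectrum (b::'a::complex_banach_algebra_1) \<noteq> {}"
proof
  assume empty: "alg_spectrum b = {}"
  define t0 where "t0 = 1 / (norm b + 1)"
  interpret punctured_resolvent b t0
  proof
    show "0 < t0" by (simp add: t0_def add_nonneg_pos)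
    fix t :: complex assume "t0 \<le> norm t"
    then have "t \<noteq> 0" using \<open>0 < t0\<close> by auto
    then show "1 - t *\<^sub>C b \<in> invertible_elems" by (simp add: invertible_one_minus_scaleC empty)
  qed
  have small: "(\<lambda>m. x ^ (2 ^ m)) \<longlonglongrightarrow> 0" if "norm x < 1" for x :: 'a
  proof (rule Lim_null_comparison)
    show "(\<lambda>m. norm x ^ (2 ^ m)) \<longlonglongrightarrow> 0" by (rule power_two_power_null[OF norm_ge_zero that])
    show "\<forall>\<^sub>F m in sequentially. norm (x ^ 2 ^ m) \<le> norm x ^ 2 ^ m"
      by (intro always_eventually allI norm_power_ineq)
  qed
  have "riesz_idem t0 = 1"
  proof -
    define X where "X m = (complex_of_real t0 *\<^sub>C b) ^ (2 ^ m)" for m :: nat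
    have "norm (complex_of_real t0 *\<^sub>C b) < 1"
      using t0_pos by (simp add: norm_scaleC) (simp add: t0_def field_simps add_nonneg_pos)
    then have "X \<longlonglongrightarrow> 0" unfolding X_def by (rule small)
    then have "(\<lambda>m. 1 + X m * pow_inv m t0) \<longlonglongrightarrow> 1 + 0 * riesz_idem t0"
      by (intro tendsto_intros pow_inv_tendsto order_refl)
    moreover have "1 + X m * pow_inv m t0 = pow_inv m t0" for m
      using pow_inv_right[of t0 m] by (simp add: X_def algebra_simps)
    ultimately show ?thesis using pow_inv_tendsto[of t0] LIMSEQ_unique by fastforce
  qed
  moreover have "riesz_idem t0 = 0"
  proof -
    have b: "b \<in> invertible_elems" using empty invertible_shift_iff[of b 0] by (simp add: scaleC.zero_left)
    define t where "t = max t0 (norm (ainv b) + 1)"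
    have t: "t0 \<le> t" "norm (ainv b) + 1 \<le> t" "0 < t" using t0_pos by (auto simp: t_def)
    define Y where "Y m = (complex_of_real (1 / t) *\<^sub>C ainv b) ^ (2 ^ m)" for m :: nat
    have "norm (complex_of_real (1 / t) *\<^sub>C ainv b) < 1"
      using t by (simp add: norm_scaleC norm_divide)
    then have Y: "Y \<longlonglongrightarrow> 0" unfolding Y_def by (rule small)
    have "Y m * pow_inv m t - Y m = pow_inv m t" for m
    proof -
      have "Y m * (complex_of_real t *\<^sub>C b) ^ (2 ^ m) = 1"
        using t by (simp add: Y_def scaleC_power scaleC_assoc power_divide ainv_power_mult b)
      moreover have "Y m * ((1 - (complex_of_real t *\<^sub>C b) ^ (2 ^ m)) * pow_inv m t) = Y m"
        using pow_inv_right[OF t(1), of m] by simp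
      ultimately show ?thesis
        by (simp add: algebra_simps flip: mult.assoc)
    qed
    moreover have "(\<lambda>m. Y m * pow_inv m t - Y m) \<longlonglongrightarrow> 0 * riesz_idem t - 0"
      by (intro tendsto_intros pow_inv_tendsto t Y)
    ultimately have "riesz_idem t = 0" using pow_inv_tendsto[OF t(1)] LIMSEQ_unique by fastforce
    then show ?thesis using riesz_idem_const[OF _ t(1)] by simp
  qed
  ultimately show False by simp
qed

section \<open>Projections in C*-algebras\<close>

lemma star_scaleR: "star (r *\<^sub>R (x::'a::cstar_algebra_1)) = r *\<^sub>R star x"
  by (simp add: scaleR_scaleC star_scaleC)

lemma star_zero [simp]: "star (0::'a::cstar_algebra_1) = 0"
  using star_scaleR[of 0 "0::'a"] by simp

lemma star_uminus: "star (- (x::'a::cstar_algebra_1)) = - star x"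
  using star_scaleR[of "-1" x] by simp

lemma star_diff: "star (x - (y::'a::cstar_algebra_1)) = star x - star y"
  using star_add[of x "- y"] by (simp add: star_uminus)

lemma star_one [simp]: "star (1::'a::cstar_algebra_1) = 1"
  by (metis mult_1 mult_1_right star_mult star_star)

lemma star_sum: "star (\<Sum>i\<in>A. f i) = (\<Sum>i\<in>A. star (f i :: 'a::cstar_algebra_1))"
  by (induction A rule: infinite_finite_induct) (simp_all add: star_add)

text \<open>With \<open>t\<close> the square of \<open>norm h\<close> and
  \<open>x = t *\<^sub>R 1 - h\<close>, the product \<open>star x * x\<close> is
  \<open>(t * t) *\<^sub>R 1 - h * h\<close>, of norm at most \<open>t * t + t\<close>. Hence
  \<open>norm x < 1 + t\<close>, and \<open>1 + h = (1 + t) *\<^sub>R 1 - x\<close> is invertible by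
  a Neumann series.\<close>

lemma invertible_one_plus_skew:
  fixes h :: "'a::cstar_algebra_1"
  assumes "star h = - h"
  shows "1 + h \<in> invertible_elems"
proof -
  define t where "t = (norm h)\<^sup>2"
  define x where "x = t *\<^sub>R 1 - h"
  have t: "t \<ge> 0" by (simp add: t_def)
  have sx: "star x = t *\<^sub>R 1 + h" by (simp add: x_def star_diff star_scaleR assms)
  have "star x * x = (t * t) *\<^sub>R 1 - h * h"
    unfolding sx unfolding x_def by (simp add: distrib_right right_diff_distrib scaleR_add_right)
  moreover have "norm (star x * x) = (norm x)\<^sup>2" by (rule cstar_identity)
  ultimately have "(norm x)\<^sup>2 = norm ((t * t) *\<^sub>R 1 - h * h)" by (simp only:)
  also have "\<dots> \<le> norm ((t * t) *\<^sub>R (1::'a)) + norm (h * h)" by (rule norm_triangle_ineq4)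
  also have "norm ((t * t) *\<^sub>R (1::'a)) = t * t" using t by simp
  also have "t * t + norm (h * h) \<le> t * t + t"
    using norm_mult_ineq[of h h] by (simp add: t_def power2_eq_square)
  also have "\<dots> < (1 + t)\<^sup>2" using t by (simp add: power2_eq_square algebra_simps)
  finally have "norm x < 1 + t" by (rule power2_less_imp_less) (use t in simp)
  then have "norm ((1 / (1 + t)) *\<^sub>R x) < 1" using t by simp
  then have "1 - (1 / (1 + t)) *\<^sub>R x \<in> invertible_elems" by (rule neumann)
  moreover have "complex_of_real (1 + t) \<noteq> 0"
    using t unfolding of_real_eq_0_iff by linarith
  ultimately have "(1 + t) *\<^sub>R (1 - (1 / (1 + t)) *\<^sub>R x) \<in> invertible_elems"
    unfolding scaleR_scaleC[of "1 + t"] using invertible_scaleC by blast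
  also have "(1 + t) *\<^sub>R (1 - (1 / (1 + t)) *\<^sub>R x) = 1 + h"
  proof -
    have "1 + t \<noteq> 0" using t by linarith
    then have "(1 + t) *\<^sub>R (1 - (1 / (1 + t)) *\<^sub>R x) = (1 + t) *\<^sub>R 1 - x"
      by (simp add: scaleR_diff_right)
    then show ?thesis by (simp add: x_def scaleR_add_left)
  qed
  finally show ?thesis .
qed

text \<open>For an idempotent \<open>e\<close> this is the standard formula for the self-adjoint
  projection with the same range as \<open>e\<close>.\<close>

definition range_proj :: "'a::cstar_algebra_1 \<Rightarrow> 'a" where
  "range_proj e = e * ainv (e + star e - 1)"

text \<open>The square of \<open>w = e + star e - 1\<close> is
  \<open>(1 + (e - star e)) * (1 - (e - star e))\<close>, a product of invertible elements since
  \<open>e - star e\<close> is skew. The inverse of \<open>w\<close> intertwines \<open>e\<close>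
  with \<open>star e\<close>, which yields all four identities.\<close>

lemma range_proj:
  fixes e :: "'a::cstar_algebra_1"
  assumes "e * e = e"
  shows "star (range_proj e) = range_proj e" "range_proj e * range_proj e = range_proj e"
    "e * range_proj e = range_proj e" "range_proj e * e = e"
proof -
  define f where "f = star e"
  have ff: "f * f = f" using assms star_mult[of e e] by (simp add: f_def)
  define w where "w = e + f - 1"
  have "(1 + (e - f)) * (1 - (e - f)) = w * w"
    by (simp add: w_def algebra_simps assms ff)
  moreover have "1 + (e - f) \<in> invertible_elems"
    by (rule invertible_one_plus_skew) (simp add: f_def star_diff star_star)
  moreover have "1 - (e - f) \<in> invertible_elems"
    using invertible_one_plus_skew[of "f - e"] by (simp add: f_def star_diff star_star algebra_simps)
  ultimately have "w * w \<in> invertible_elems" using invertible_mult by metis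
  then have w: "w \<in> invertible_elems" using invertible_factor by blast
  have ew: "e * w = w * f" and we: "w * e = f * w"
    by (simp_all add: w_def algebra_simps assms ff)
  define v where "v = ainv w"
  have v: "w * v = 1" "v * w = 1" using ainv[OF w] by (simp_all add: v_def)
  have ev: "e * v = v * f"
  proof -
    have "v * (w * e) * v = v * (f * w) * v" by (simp add: we)
    then have "(v * w) * (e * v) = (v * f) * (w * v)" by (simp only: mult.assoc)
    then show ?thesis by (simp add: v)
  qed
  have ve: "v * e = f * v"
  proof -
    have "v * (e * w) * v = v * (w * f) * v" by (simp add: ew)
    then have "(v * e) * (w * v) = (v * w) * (f * v)" by (simp only: mult.assoc)
    then show ?thesis by (simp add: v)
  qed
  have eff: "e * f = e * w" by (simp add: w_def algebra_simps assms)
  have s: "range_proj e = e * v" by (simp add: range_proj_def v_def w_def f_def)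
  show e_s: "e * range_proj e = range_proj e" by (simp add: s assms flip: mult.assoc)
  have "range_proj e * e = e * f * v" by (simp add: s mult.assoc ve)
  also have "\<dots> = e" by (simp add: eff mult.assoc v)
  finally show s_e: "range_proj e * e = e" .
  have "range_proj e * range_proj e = range_proj e * e * v" by (simp add: s mult.assoc)
  then show "range_proj e * range_proj e = range_proj e" by (simp only: s_e) (simp add: s)
  have sw: "star w = w" by (simp add: w_def f_def star_diff star_add star_star add.commute)
  have "w * star v = star (v * w)" "star v * w = star (w * v)" by (simp_all add: star_mult sw)
  then have "ainv w = star v" by (intro ainv_eq) (simp_all only: v star_one)
  then have "star v = v" by (metis v_def)
  then have "star (range_proj e) = v * f" by (simp add: s star_mult f_def)
  then show "star (range_proj e) = range_proj e" by (simp add: s ev)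
qed

lemma norm_projection_le:
  fixes q :: "'a::cstar_algebra_1"
  assumes "star q = q" "q * q = q"
  shows "norm q \<le> 1"
proof -
  have "norm q * norm q = norm q"
    using cstar_identity[of q] unfolding assms power2_eq_square by simp
  then show ?thesis by auto
qed

text \<open>The triangle inequality loses a factor \<open>card F\<close>. Repeated squaring by the
  C*-identity leaves that factor unchanged while the two sides grow like \<open>2 ^ n\<close>-th
  powers, so it becomes negligible.\<close>

lemma norm_orthogonal_sum_le:
  fixes q :: "'i \<Rightarrow> 'a::cstar_algebra_1"
  assumes "finite F" "\<And>i. i \<in> F \<Longrightarrow> star (q i) = q i"
    "\<And>i j. i \<in> F \<Longrightarrow> j \<in> F \<Longrightarrow> q i * q j = (if i = j then q i else 0)"
    "0 \<le> B" "\<And>i. i \<in> F \<Longrightarrow> norm (\<alpha> i) \<le> B"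
  shows "norm (\<Sum>i\<in>F. \<alpha> i *\<^sub>C q i) \<le> B"
proof -
  \<comment> \<open>Stated for arbitrary coefficients because the induction step replaces
    \<open>\<beta> i\<close> by its squared modulus and \<open>M\<close> by
    \<open>M * M\<close>.\<close>
  have pow: "norm (\<Sum>i\<in>F. \<beta> i *\<^sub>C q i) ^ (2 ^ n) \<le> card F * M ^ (2 ^ n)"
    if "0 \<le> M" "\<And>i. i \<in> F \<Longrightarrow> norm (\<beta> i) \<le> M" for \<beta> n and M :: real
    using that
  proof (induction n arbitrary: \<beta> M)
    case 0
    have "norm (\<beta> i *\<^sub>C q i) \<le> M * 1" if "i \<in> F" for i
      unfolding norm_scaleC using that 0 assms(2)[of i] assms(3)[of i i]
      by (intro mult_mono norm_projection_le) auto
    then have "norm (\<Sum>i\<in>F. \<beta> i *\<^sub>C q i) \<le> (\<Sum>i\<in>F. M * 1)" by (rule sum_norm_le)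
    then show ?case by simp
  next
    case (Suc n)
    define h where "h = (\<Sum>i\<in>F. \<beta> i *\<^sub>C q i)"
    have "star h * h = (\<Sum>i\<in>F. \<Sum>j\<in>F. (cnj (\<beta> i) * \<beta> j) *\<^sub>C (q i * q j))"
      by (simp add: h_def star_sum star_scaleC assms(2) sum_product scaleC_assoc mult.commute cong: sum.cong)
    also have "\<dots> = (\<Sum>i\<in>F. \<Sum>j\<in>F. if i = j then (cnj (\<beta> i) * \<beta> i) *\<^sub>C q i else 0)"
      by (intro sum.cong refl) (simp add: assms(3) scaleC.zero_right)
    also have "\<dots> = (\<Sum>i\<in>F. (cnj (\<beta> i) * \<beta> i) *\<^sub>C q i)" using assms(1) by simp
    finally have "(norm h)\<^sup>2 = norm (\<Sum>i\<in>F. (cnj (\<beta> i) * \<beta> i) *\<^sub>C q i)" by (metis cstar_identity)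
    then have "norm h ^ (2 ^ Suc n) = norm (\<Sum>i\<in>F. (cnj (\<beta> i) * \<beta> i) *\<^sub>C q i) ^ (2 ^ n)"
      by (simp only: power_Suc power_mult)
    also have "\<dots> \<le> card F * (M * M) ^ (2 ^ n)"
      using Suc.prems by (intro Suc.IH) (auto simp: norm_mult intro!: mult_mono)
    also have "(M * M) ^ (2 ^ n) = M ^ (2 ^ Suc n)"
      by (simp add: power2_eq_square[symmetric] flip: power_mult)
    finally show ?case by (simp add: h_def)
  qed
  define N where "N = norm (\<Sum>i\<in>F. \<alpha> i *\<^sub>C q i)"
  show ?thesis
  proof (rule ccontr)
    assume "\<not> ?thesis"
    then have N: "B < N" "0 < N" using assms(4) by (auto simp: N_def)
    have "(\<lambda>n. card F * (B / N) ^ (2 ^ n)) \<longlonglongrightarrow> 0"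
      using N assms(4) by (intro tendsto_mult_right_zero power_two_power_null) auto
    then have "\<forall>\<^sub>F n in sequentially. card F * (B / N) ^ (2 ^ n) < 1"
      by (rule order_tendstoD) simp
    then obtain n where n: "card F * (B / N) ^ (2 ^ n) < 1" using eventually_happens by fastforce
    then have "card F * B ^ (2 ^ n) < N ^ (2 ^ n)" using N by (simp add: power_divide field_simps)
    moreover have "N ^ (2 ^ n) \<le> card F * B ^ (2 ^ n)" unfolding N_def using assms by (intro pow) auto
    ultimately show False by simp
  qed
qed

section \<open>Moving the diagonal of a triangular element\<close>

text \<open>Zero idempotents are allowed, so finite families are included. The assumption on points
  outside \<open>\<Lambda>\<close> gives a right inverse modulo finitely many \<open>P i\<close>,
  which is what left approximate eigenvectors are tested against.\<close>

locale discrete_spectral_family =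
  fixes a :: "'a::cstar_algebra_1" and P :: "nat \<Rightarrow> 'a" and \<mu> \<nu> :: "nat \<Rightarrow> complex"
    and \<Lambda> :: "complex set"
  assumes idem: "P n * P n = P n"
    and orth: "m \<noteq> n \<Longrightarrow> P m * P n = 0"
    and comm: "a * P n = P n * a"
    and nilp: "locally_quasinilpotent (a - \<mu> n *\<^sub>C 1) (P n)"
    and shift_null: "(\<lambda>n. \<mu> n - \<nu> n) \<longlonglongrightarrow> 0"
    and target: "\<nu> n \<in> \<Lambda>"
    and finite_target: "finite \<Lambda>"
    and cover: "l \<notin> \<Lambda> \<Longrightarrow> \<exists>m z. (l *\<^sub>C 1 - a) * z = 1 - (\<Sum>i<m. P i)"
begin

section \<open>Range projections and the triangular form\<close>

definition e :: "nat \<Rightarrow> 'a" where "e n = (\<Sum>i<n. P i)"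

definition s :: "nat \<Rightarrow> 'a" where "s n = range_proj (e n)"

definition q :: "nat \<Rightarrow> 'a" where "q n = s (Suc n) - s n"

lemma e_P: "n \<le> k \<Longrightarrow> e n * P k = 0" "n \<le> k \<Longrightarrow> P k * e n = 0"
  by (auto simp: e_def sum_distrib_left sum_distrib_right intro!: sum.neutral orth)

lemma e_Suc: "e (Suc n) = e n + P n"
  by (simp add: e_def)

lemma e_idem: "e n * e n = e n"
  by (induction n) (simp_all add: e_Suc distrib_left distrib_right e_P idem, simp add: e_def)

lemma e_comm: "a * e n = e n * a"
  by (simp add: e_def sum_distrib_left sum_distrib_right comm)

lemmas s_props = range_proj[OF e_idem, folded s_def]

lemma s_0: "s 0 = 0"
  by (simp add: s_def range_proj_def e_def)

lemma s_Suc_s: "s (Suc n) * s n = s n"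
proof -
  have "e (Suc n) * e n = e n" by (simp add: e_Suc distrib_right e_P e_idem)
  then have "e (Suc n) * (e n * s n) = e n * s n" by (simp flip: mult.assoc)
  then have *: "e (Suc n) * s n = s n" by (simp only: s_props(3))
  have "s (Suc n) * (e (Suc n) * s n) = e (Suc n) * s n" by (simp add: s_props flip: mult.assoc)
  then show ?thesis by (simp only: *)
qed

lemma s_absorb:
  assumes "m \<le> n" shows "s n * s m = s m" "s m * s n = s m"
proof -
  show "s n * s m = s m"
    using assms
  proof (induction n rule: dec_induct)
    case (step n)
    have "s (Suc n) * s m = s (Suc n) * s n * s m" using step by (simp add: mult.assoc)
    also have "\<dots> = s m" using step by (simp add: s_Suc_s)
    finally show ?case .
  qed (rule s_props)
  \<comment> \<open>Adjoints exchange the two absorption laws, the \<open>s n\<close> being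
    self-adjoint.\<close>
  then have "star (s n * s m) = star (s m)" by (simp only:)
  then show "s m * s n = s m" by (simp only: star_mult s_props(1))
qed

lemma q_star: "star (q n) = q n"
  by (simp add: q_def star_diff s_props)

lemma s_q: "n < m \<Longrightarrow> s m * q n = q n" "m \<le> n \<Longrightarrow> s m * q n = 0"
  by (simp_all add: q_def right_diff_distrib s_absorb)

lemma q_s: "n < m \<Longrightarrow> q n * s m = q n" "m \<le> n \<Longrightarrow> q n * s m = 0"
  by (simp_all add: q_def left_diff_distrib s_absorb)

lemma q_q: "q m * q n = (if m = n then q m else 0)"
proof (cases m n rule: linorder_cases)
  case less
  then have "q m * q n = q m * (s n * q n)" by (metis q_s(1) mult.assoc)
  then show ?thesis using less by (simp add: s_q)
next
  case equal
  then show ?thesis by (simp add: q_def left_diff_distrib right_diff_distrib s_absorb)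
next
  case greater
  then have "q m * q n = q m * s m * q n" by (simp add: mult.assoc s_q)
  then show ?thesis using greater by (simp add: q_s)
qed

lemma norm_q_le: "norm (q n) \<le> 1"
  by (rule norm_projection_le) (simp_all add: q_star q_q)

text \<open>An element commuting with \<open>e n\<close> preserves the range of \<open>e n\<close>,
  which is also the range of \<open>s n\<close>.\<close>

lemma s_invariant:
  assumes "b * e n = e n * b" shows "b * s n = s n * b * s n"
proof -
  have "b * s n = b * (e n * s n)" by (simp only: s_props)
  also have "\<dots> = e n * (b * s n)" by (simp only: assms flip: mult.assoc)
  finally have eb: "e n * (b * s n) = b * s n" ..
  have "s n * b * s n = s n * (e n * (b * s n))" by (simp only: eb) (simp only: mult.assoc)
  also have "\<dots> = e n * (b * s n)" by (simp only: s_props flip: mult.assoc)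
  finally show ?thesis by (simp only: eb)
qed

text \<open>Column \<open>n\<close> of the triangular form: \<open>b\<close> preserves the range of
  \<open>s (Suc n)\<close>, and \<open>s (Suc n) = s n + q n\<close> separates the part above the
  diagonal from the diagonal block.\<close>

lemma s_q_split:
  assumes "\<And>k. b * e k = e k * b"
  shows "b * q n = s n * (b * q n) + q n * (b * q n)"
proof -
  have sq: "s (Suc n) * q n = q n" by (simp add: s_q)
  have "b * q n = b * s (Suc n) * q n" by (simp only: mult.assoc sq)
  also have "\<dots> = s (Suc n) * b * s (Suc n) * q n" by (subst s_invariant[OF assms]) (rule refl)
  also have "\<dots> = s (Suc n) * (b * q n)" by (simp only: mult.assoc sq)
  also have "\<dots> = (s n + q n) * (b * q n)" by (simp add: q_def)
  also have "\<dots> = s n * (b * q n) + q n * (b * q n)" by (rule distrib_right)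
  finally show ?thesis .
qed

lemma e_q: "e (Suc n) * q n = q n"
  by (metis s_props(3) s_q(1) lessI mult.assoc)

lemma q_e: "q n * e n = 0"
proof -
  have "q n * e n = q n * s n * e n" by (simp add: mult.assoc s_props)
  then show ?thesis by (simp add: q_s)
qed

text \<open>As for triangular matrices, taking a diagonal block is compatible with powers: the part
  of \<open>b ^ N * q n\<close> in the range of \<open>s n\<close> is killed because
  \<open>q n * b * s n = 0\<close>.\<close>

lemma compression_power:
  assumes "\<And>k. b * e k = e k * b" "1 \<le> N"
  shows "(q n * b * q n) ^ N = q n * b ^ N * q n"
  using assms(2)
proof (induction N rule: dec_induct)
  case (step N)
  have bN: "b ^ N * e k = e k * b ^ N" for k
    using power_commuting_commutes[OF assms(1)] .
  note split = s_q_split[OF bN]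
  have qq: "q n * (q n * x) = q n * x" for x by (simp add: q_q flip: mult.assoc)
  have "q n * b * s n = q n * (s n * (b * s n))" using s_invariant[OF assms(1), of n] by (simp add: mult.assoc)
  then have zero: "q n * b * s n = 0" using q_s(2)[of n n] by (simp flip: mult.assoc)
  have zero': "q n * (b * (s n * x)) = 0" for x
    using arg_cong[OF zero, of "\<lambda>u. u * x"] by (simp add: mult.assoc)
  have "(q n * b * q n) ^ Suc N = q n * b * q n * (q n * (b ^ N * q n))"
    using step by (simp add: mult.assoc)
  also have "\<dots> = q n * b * (q n * (b ^ N * q n))"
    by (simp add: mult.assoc qq)
  also have "\<dots> = q n * b * (b ^ N * q n) - q n * b * s n * (b ^ N * q n)"
  proof -
    have "q n * (b ^ N * q n) = b ^ N * q n - s n * (b ^ N * q n)"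
      using split[of n] by (metis add_diff_cancel_left')
    then have "q n * b * (q n * (b ^ N * q n)) = q n * b * (b ^ N * q n - s n * (b ^ N * q n))"
      by (rule arg_cong)
    then show ?thesis by (simp only: right_diff_distrib mult.assoc)
  qed
  also have "\<dots> = q n * b ^ Suc N * q n" by (simp add: zero' mult.assoc)
  finally show ?case .
qed simp

text \<open>Inserting \<open>e (Suc n) = e n + P n\<close> in front of the right-hand
  \<open>q n\<close>, the \<open>e n\<close> part vanishes by \<open>q_e\<close>. Thus the diagonal
  block inherits its decay from \<open>P n\<close>, without any loss from the norm of
  \<open>P n\<close>.\<close>

lemma compression_norm_le:
  assumes "\<And>k. b * e k = e k * b" "1 \<le> N"
  shows "norm ((q n * b * q n) ^ N) \<le> norm (b ^ N * P n)"
proof -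
  have bN: "b ^ N * e k = e k * b ^ N" for k
    using power_commuting_commutes[OF assms(1)] .
  have "q n * b ^ N * q n = q n * b ^ N * (e (Suc n) * q n)" by (simp add: e_q)
  also have "\<dots> = q n * (b ^ N * e n) * q n + q n * (b ^ N * P n) * q n"
    by (simp add: e_Suc algebra_simps)
  also have "q n * (b ^ N * e n) = 0" by (simp add: bN q_e flip: mult.assoc)
  finally have "(q n * b * q n) ^ N = q n * (b ^ N * P n) * q n"
    using compression_power[OF assms] by simp
  also have "norm \<dots> \<le> norm (q n) * norm (b ^ N * P n) * norm (q n)"
    by (meson norm_mult_ineq mult_right_mono norm_ge_zero order_trans)
  also have "\<dots> \<le> 1 * norm (b ^ N * P n) * 1"
    using norm_q_le by (intro mult_mono) auto
  finally show ?thesis by simp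
qed

section \<open>The diagonal correction and the spectrum after subtracting it\<close>

definition C :: "nat \<Rightarrow> 'a" where "C n = (\<Sum>k<n. (\<mu> k - \<nu> k) *\<^sub>C q k)"

definition c :: 'a where "c = lim C"

text \<open>The \<open>q k\<close> are orthogonal projections, so a tail of the series has norm at
  most a bound on its coefficients, and these tend to 0.\<close>

lemma C_tendsto: "C \<longlonglongrightarrow> c"
proof -
  have "Cauchy C"
  proof (rule CauchyI')
    fix \<epsilon> :: real assume "0 < \<epsilon>"
    then have "\<forall>\<^sub>F n in sequentially. norm (\<mu> n - \<nu> n) < \<epsilon> / 2"
      using order_tendstoD(2)[OF tendsto_norm_zero[OF shift_null], of "\<epsilon> / 2"] by simp
    then obtain M where M: "\<And>n. n \<ge> M \<Longrightarrow> norm (\<mu> n - \<nu> n) < \<epsilon> / 2"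
      unfolding eventually_sequentially by blast
    have "norm (C m - C n) < \<epsilon>" if "M \<le> m" "m < n" for m n
    proof -
      have "C n - C m = (\<Sum>k\<in>{m..<n}. (\<mu> k - \<nu> k) *\<^sub>C q k)"
        using that sum_diff_nat_ivl[of 0 m n "\<lambda>k. (\<mu> k - \<nu> k) *\<^sub>C q k"]
        by (simp add: C_def atLeast0LessThan)
      also have "norm \<dots> \<le> \<epsilon> / 2"
        using that M \<open>0 < \<epsilon>\<close>
        by (intro norm_orthogonal_sum_le) (auto simp: q_star q_q intro!: less_imp_le)
      finally show ?thesis using \<open>0 < \<epsilon>\<close> by (simp add: norm_minus_commute)
    qed
    then show "\<exists>M. \<forall>m\<ge>M. \<forall>n>m. dist (C m) (C n) < \<epsilon>" unfolding dist_norm by blast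
  qed
  then show ?thesis unfolding c_def by (simp add: Cauchy_convergent_iff convergent_LIMSEQ_iff)
qed

lemma s_C: "s n * C n = C n"
  by (auto simp: C_def sum_distrib_left scaleC_assoc s_q intro!: sum.cong)

lemma c_q: "c * q n = (\<mu> n - \<nu> n) *\<^sub>C q n"
proof (rule LIMSEQ_unique)
  show "(\<lambda>N. C N * q n) \<longlonglongrightarrow> c * q n" by (intro tendsto_mult tendsto_const C_tendsto)
  have "C N * q n = (\<mu> n - \<nu> n) *\<^sub>C q n" if "Suc n \<le> N" for N
  proof -
    have "C N * q n = (\<Sum>k<N. if n = k then (\<mu> n - \<nu> n) *\<^sub>C q n else 0)"
      unfolding C_def sum_distrib_right
      by (intro sum.cong refl) (auto simp: scaleC_assoc q_q scaleC.zero_right)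
    then show ?thesis using that by simp
  qed
  then have "\<forall>\<^sub>F N in sequentially. C N * q n = (\<mu> n - \<nu> n) *\<^sub>C q n"
    unfolding eventually_sequentially by blast
  then show "(\<lambda>N. C N * q n) \<longlonglongrightarrow> (\<mu> n - \<nu> n) *\<^sub>C q n" by (rule tendsto_eventually)
qed

text \<open>Column by column: the part of column \<open>n\<close> above the diagonal is multiplied
  by \<open>y k * s n\<close>, which tends to 0 by induction. The diagonal block is invertible, so
  \<open>y k * q n\<close> tends to 0 as well.\<close>

lemma approx_eigen_s:
  assumes l: "l \<notin> \<Lambda>" and y: "(\<lambda>k. y k * (l *\<^sub>C 1 - (a - c))) \<longlonglongrightarrow> 0"
  shows "(\<lambda>k. y k * s n) \<longlonglongrightarrow> 0"
proof (induction n)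
  case 0
  then show ?case by (simp add: s_0)
next
  case (Suc n)
  define b where "b = a - \<mu> n *\<^sub>C 1"
  define h where "h = (l - \<nu> n) *\<^sub>C 1 - b"
  \<comment> \<open>Up to the factor \<open>l - \<nu> n\<close>, the diagonal block
    \<open>q n * h * q n\<close> equals \<open>q n * w\<close>, and \<open>w\<close> is invertible
    in the whole algebra because the compression is quasinilpotent.\<close>
  define w where "w = 1 - (1 / (l - \<nu> n)) *\<^sub>C (q n * b * q n)"
  have be: "b * e k = e k * b" for k
    by (simp add: b_def algebra_simps e_comm scaleC_assoc)
  have l\<nu>: "l - \<nu> n \<noteq> 0" using l target[of n] by auto
  have w: "w \<in> invertible_elems"
    unfolding w_def using nilp[of n] compression_norm_le[OF be]
    by (intro invertible_one_minus_power_le) (simp_all add: b_def)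
  have hq: "h * q n = s n * (h * q n) + q n * (h * q n)"
    by (rule s_q_split) (simp add: h_def left_diff_distrib right_diff_distrib be scaleC_assoc)
  \<comment> \<open>On \<open>q n\<close>, subtracting \<open>c\<close> shifts the diagonal value
    from \<open>\<mu> n\<close> to \<open>\<nu> n\<close>.\<close>
  have gq: "(l *\<^sub>C 1 - (a - c)) * q n = h * q n"
    by (simp add: h_def b_def algebra_simps c_q scaleC_assoc scaleC.diff_left)
  have "y k * (l *\<^sub>C 1 - (a - c)) * q n = y k * s n * (h * q n) + y k * (q n * (h * q n))" for k
  proof -
    have "y k * (l *\<^sub>C 1 - (a - c)) * q n = y k * (h * q n)" by (simp only: mult.assoc gq)
    also have "\<dots> = y k * (s n * (h * q n) + q n * (h * q n))" by (rule arg_cong[OF hq])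
    finally show ?thesis by (simp only: distrib_left mult.assoc)
  qed
  moreover have "q n * (h * q n) = (l - \<nu> n) *\<^sub>C (q n * w)"
    using l\<nu> by (simp add: h_def w_def algebra_simps scaleC_assoc scaleC.diff_right q_q
        flip: mult.assoc[of "q n" "q n"])
  ultimately have "y k * q n = (1 / (l - \<nu> n)) *\<^sub>C
      ((y k * (l *\<^sub>C 1 - (a - c)) * q n - y k * s n * (h * q n)) * ainv w)" for k
    using l\<nu> by (simp add: scaleC_assoc mult.assoc ainv w)
  moreover have "(\<lambda>k. (1 / (l - \<nu> n)) *\<^sub>C
      ((y k * (l *\<^sub>C 1 - (a - c)) * q n - y k * s n * (h * q n)) * ainv w))
      \<longlonglongrightarrow> (1 / (l - \<nu> n)) *\<^sub>C ((0 * q n - 0 * (h * q n)) * ainv w)"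
    by (intro scaleC.tendsto tendsto_intros y Suc.IH)
  ultimately have "(\<lambda>k. y k * q n) \<longlonglongrightarrow> 0" by (simp add: scaleC.zero_right)
  from tendsto_add[OF Suc.IH this] show ?case by (simp add: q_def algebra_simps)
qed

text \<open>Each partial sum satisfies \<open>C n = s n * C n\<close>, so it is annihilated in the
  limit; as the \<open>y k\<close> have norm 1, replacing \<open>c\<close> by \<open>C n\<close>
  costs at most \<open>norm (C n - c)\<close>, uniformly in \<open>k\<close>.\<close>

lemma approx_eigen_c:
  assumes l: "l \<notin> \<Lambda>" and y: "(\<lambda>k. y k * (l *\<^sub>C 1 - (a - c))) \<longlonglongrightarrow> 0" "\<And>k. norm (y k) = 1"
  shows "(\<lambda>k. y k * c) \<longlonglongrightarrow> 0"
proof (rule tendsto_norm_zero_cancel, rule order_tendstoI)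
  fix \<epsilon> :: real assume "0 < \<epsilon>"
  then have "\<forall>\<^sub>F n in sequentially. norm (C n - c) < \<epsilon> / 2"
    using order_tendstoD(2)[OF tendsto_norm_zero[OF LIM_zero[OF C_tendsto]], of "\<epsilon> / 2"] by simp
  then obtain n where n: "norm (C n - c) < \<epsilon> / 2" using eventually_happens by fastforce
  have "(\<lambda>k. y k * s n * C n) \<longlonglongrightarrow> 0 * C n"
    by (intro tendsto_intros approx_eigen_s[OF l y(1)])
  then have "(\<lambda>k. y k * C n) \<longlonglongrightarrow> 0" by (simp add: mult.assoc s_C)
  from order_tendstoD(2)[OF tendsto_norm_zero[OF this], of "\<epsilon> / 2"] \<open>0 < \<epsilon>\<close>
  have "\<forall>\<^sub>F k in sequentially. norm (y k * C n) < \<epsilon> / 2" by simp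
  then show "\<forall>\<^sub>F k in sequentially. norm (y k * c) < \<epsilon>"
  proof eventually_elim
    case (elim k)
    have "norm (y k * c) = norm (y k * C n - y k * (C n - c))" by (simp add: algebra_simps)
    also have "\<dots> \<le> norm (y k * C n) + norm (y k * (C n - c))" by (rule norm_triangle_ineq4)
    also have "norm (y k * (C n - c)) \<le> norm (C n - c)"
      using norm_mult_ineq[of "y k" "C n - c"] y(2) by simp
    finally show ?case using elim n by simp
  qed
qed (auto intro!: always_eventually elim: order.strict_trans2)

theorem spectrum_minus_diagonal: "alg_spectrum (a - c) \<subseteq> \<Lambda>"
proof -
  have "frontier (alg_spectrum (a - c)) \<subseteq> \<Lambda>"
  proof (rule subsetI, rule ccontr)
    fix l assume "l \<in> frontier (alg_spectrum (a - c))" and l: "l \<notin> \<Lambda>"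
    then obtain y :: "nat \<Rightarrow> 'a" where y: "\<And>k. norm (y k) = 1"
      "(\<lambda>k. y k * (l *\<^sub>C 1 - (a - c))) \<longlonglongrightarrow> 0"
      using frontier_spectrum_approx by blast
    obtain m z where mz: "(l *\<^sub>C 1 - a) * z = 1 - e m" using cover[OF l] unfolding e_def by blast
    have "(\<lambda>k. (y k * (l *\<^sub>C 1 - (a - c)) - y k * c) * z + y k * s m * e m) \<longlonglongrightarrow> (0 - 0) * z + 0 * e m"
      using l y by (intro tendsto_intros approx_eigen_s approx_eigen_c) auto
    \<comment> \<open>The expression collapses to \<open>y k * (1 - e m) + y k * e m\<close>, since
      \<open>s m * e m = e m\<close>; so the normalised \<open>y k\<close> would tend to 0.\<close>
    moreover have "(y k * (l *\<^sub>C 1 - (a - c)) - y k * c) * z + y k * s m * e m = y k" for k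
    proof -
      have "(y k * (l *\<^sub>C 1 - (a - c)) - y k * c) * z = y k * ((l *\<^sub>C 1 - a) * z)"
        by (simp add: algebra_simps)
      then show ?thesis by (simp add: mz mult.assoc s_props) (simp add: algebra_simps)
    qed
    ultimately have "y \<longlonglongrightarrow> 0" by simp
    then have "(\<lambda>k. norm (y k)) \<longlonglongrightarrow> norm (0::'a)" by (intro tendsto_intros)
    then show False using y(1) by (simp add: LIMSEQ_const_iff)
  qed
  moreover from this have "countable (frontier (alg_spectrum (a - c)))"
    using finite_target by (meson countable_finite finite_subset)
  ultimately show ?thesis
    using frontier_subset_imp_subset[OF bounded_spectrum closed_spectrum] by blast
qed

end

section \<open>Polynomials and homomorphisms\<close>

lemma alg_poly_0 [simp]: "alg_poly 0 x = 0"
  by (simp add: alg_poly_def scaleC.zero_left)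

lemma alg_poly_pCons: "alg_poly (pCons c p) x = c *\<^sub>C 1 + x * alg_poly p x"
proof (cases "p = 0")
  case False
  then have "alg_poly (pCons c p) x =
      (\<Sum>i\<le>Suc (degree p). coeff (pCons c p) i *\<^sub>C x ^ i)" by (simp add: alg_poly_def)
  also have "\<dots> = c *\<^sub>C 1 + (\<Sum>i\<le>degree p. coeff p i *\<^sub>C x ^ Suc i)"
    by (subst sum.atMost_Suc_shift) simp
  finally show ?thesis by (simp add: alg_poly_def sum_distrib_left mult_scaleC_right)
qed (simp add: alg_poly_def scaleC.zero_left)

lemma alg_poly_add: "alg_poly (p + q) x = alg_poly p x + alg_poly q x"
  by (induction p q rule: poly_induct2) (simp_all add: alg_poly_pCons scaleC.add_left algebra_simps)

lemma alg_poly_smult: "alg_poly (smult c p) x = c *\<^sub>C alg_poly p x"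
  by (induction p) (simp_all add: alg_poly_pCons scaleC.add_right scaleC_assoc scaleC.zero_right)

lemma alg_poly_mult: "alg_poly (p * q) x = alg_poly p x * alg_poly q x"
  by (induction p)
    (simp_all add: alg_poly_pCons alg_poly_add alg_poly_smult scaleC.zero_left scaleC_assoc
      distrib_right mult.assoc)

lemma alg_poly_linear: "alg_poly [:- l, 1:] x = x - l *\<^sub>C 1"
  by (simp add: alg_poly_pCons scaleC.minus_left scaleC.zero_left)

lemma alg_poly_invertible:
  fixes x :: "'a::complex_banach_algebra_1"
  assumes "Q \<noteq> 0" "\<And>r. poly Q r = 0 \<Longrightarrow> r \<notin> alg_spectrum x"
  shows "alg_poly Q x \<in> invertible_elems"
  using assms
proof (induction "degree Q" arbitrary: Q)
  case 0
  then obtain c where "Q = [:c:]" "c \<noteq> 0" by (metis degree_eq_zeroE pCons_0_0)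
  then show ?case using invertible_scaleC[of c "1::'a"] invertibleI[of "1::'a" 1] by (simp add: alg_poly_pCons)
next
  case (Suc n)
  then have "\<not> constant (poly Q)" by (simp add: constant_degree)
  then obtain r where r: "poly Q r = 0" using fundamental_theorem_of_algebra by blast
  then obtain Q' where Q': "Q = [:- r, 1:] * Q'" unfolding poly_eq_0_iff_dvd by (rule dvdE)
  then have "Q' \<noteq> 0" using Suc.prems(1) by auto
  then have "degree Q = Suc (degree Q')" unfolding Q' by (subst degree_mult_eq) auto
  then have "alg_poly Q' x \<in> invertible_elems"
    using Suc.hyps Suc.prems \<open>Q' \<noteq> 0\<close> by (intro Suc.hyps(1)) (auto simp: Q')
  moreover have "x - r *\<^sub>C 1 \<in> invertible_elems"
    using Suc.prems(2)[OF r] by (simp add: invertible_shift_iff)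
  ultimately show ?case by (simp add: Q' alg_poly_mult alg_poly_linear invertible_mult del: mult_pCons_left)
qed

text \<open>\<open>x - l *\<^sub>C 1\<close> is a commuting factor of
  \<open>alg_poly P x - poly P l *\<^sub>C 1\<close>, so invertibility of the latter would pass to
  it.\<close>

lemma poly_spectrum:
  assumes "l \<in> alg_spectrum x"
  shows "poly P l \<in> alg_spectrum (alg_poly P x)"
proof (rule ccontr)
  assume "\<not> ?thesis"
  then have "alg_poly P x - poly P l *\<^sub>C 1 \<in> invertible_elems" by (simp add: invertible_shift_iff)
  also have "alg_poly P x - poly P l *\<^sub>C 1 = alg_poly (P + [:- poly P l:]) x"
    by (simp add: alg_poly_add alg_poly_pCons scaleC.minus_left)
  finally have inv: "alg_poly (P + [:- poly P l:]) x \<in> invertible_elems" .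
  have "poly (P + [:- poly P l:]) l = 0" by simp
  then obtain Q where Q: "P + [:- poly P l:] = [:- l, 1:] * Q"
    unfolding poly_eq_0_iff_dvd by (rule dvdE)
  have "alg_poly [:- l, 1:] x * alg_poly Q x = alg_poly Q x * alg_poly [:- l, 1:] x"
    by (metis alg_poly_mult mult.commute)
  then have "alg_poly [:- l, 1:] x \<in> invertible_elems"
    by (rule invertible_factor) (use inv in \<open>simp only: Q alg_poly_mult\<close>)
  then show False using assms by (simp add: alg_poly_linear invertible_shift_iff)
qed

lemma spectrum_shift: "z \<in> alg_spectrum (x - m *\<^sub>C 1) \<longleftrightarrow> z + m \<in> alg_spectrum x"
  by (simp add: alg_spectrum_def scaleC.add_left algebra_simps)

text \<open>Each isolated point is singled out by a member of a countable basis that meets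
  \<open>K\<close> in that point alone.\<close>

lemma countable_iso_points: "countable (iso_points K)"
proof -
  obtain B :: "complex set set" where B: "countable B" "topological_basis B"
    using ex_countable_basis by blast
  have "\<exists>b\<in>B. b \<inter> K = {z}" if z: "z \<in> iso_points K" for z
  proof -
    obtain U where U: "z \<in> K" "open U" "U \<inter> K = {z}"
      using z by (auto simp: iso_points_def isolated_in_def)
    then have "z \<in> U" by auto
    then obtain b where "b \<in> B" "z \<in> b" "b \<subseteq> U" using topological_basisE[OF B(2) U(2)] by metis
    with U show ?thesis by blast
  qed
  then obtain f where f: "\<And>z. z \<in> iso_points K \<Longrightarrow> f z \<in> B \<and> f z \<inter> K = {z}" by metis
  have "inj_on f (iso_points K)" by (rule inj_onI) (metis f singleton_inject)
  moreover have "countable (f ` iso_points K)" using f B(1) by (meson countable_subset image_subsetI)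
  ultimately show ?thesis by (metis countable_image_inj_on)
qed

section \<open>Bounded homomorphisms and quasinilpotent parts\<close>

locale bounded_unital_hom =
  fixes T :: "'a::complex_banach_algebra_1 \<Rightarrow> 'b::complex_banach_algebra_1"
  assumes hom: "unital_hom T" and bounded: "bounded_linear T"
begin

lemma T_simps: "T (x + y) = T x + T y" "T (c *\<^sub>C x) = c *\<^sub>C T x" "T (x * y) = T x * T y" "T 1 = 1"
  using hom by (simp_all add: unital_hom_def)

lemma T_diff: "T (x - y) = T x - T y"
  using linear_diff[OF bounded_linear.linear[OF bounded]] .

lemma T_zero: "T 0 = 0"
  using linear_0[OF bounded_linear.linear[OF bounded]] .

lemma T_power: "T (x ^ n) = T x ^ n"
  by (induction n) (simp_all add: T_simps)

lemma T_alg_poly: "T (alg_poly P x) = alg_poly P (T x)"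
  by (induction P) (simp_all add: alg_poly_pCons T_simps T_zero)

lemma T_invertible: "x \<in> invertible_elems \<Longrightarrow> T x \<in> invertible_elems"
  by (rule invertibleI[of _ "T (ainv x)"]) (simp_all add: ainv T_simps(4) flip: T_simps(3))

lemma hom_spectrum_subset_weyl: "hom_spectrum T x \<subseteq> weyl_spectrum T x"
proof
  fix l assume l: "l \<in> hom_spectrum T x"
  show "l \<in> weyl_spectrum T x"
  proof (rule ccontr)
    assume "l \<notin> weyl_spectrum T x"
    then obtain c d where cd: "l *\<^sub>C 1 - x = c + d" "T c = 0" "d \<in> invertible_elems"
      by (auto simp: weyl_spectrum_def hom_weyl_def hom_kernel_def)
    have "l *\<^sub>C 1 - T x = T (l *\<^sub>C 1 - x)" by (simp add: T_diff T_simps)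
    then have "l *\<^sub>C 1 - T x \<in> invertible_elems" using cd by (simp add: T_simps T_invertible)
    then show False using l by (simp add: hom_spectrum_def alg_spectrum_def)
  qed
qed

lemma hom_spectrum_subset: "hom_spectrum T x \<subseteq> alg_spectrum x"
proof
  fix l assume "l \<in> hom_spectrum T x"
  then have "T (l *\<^sub>C 1 - x) \<notin> invertible_elems"
    by (simp add: hom_spectrum_def alg_spectrum_def T_diff T_simps)
  then show "l \<in> alg_spectrum x" using T_invertible by (auto simp: alg_spectrum_def)
qed

text \<open>Spectral mapping places the spectrum of \<open>T x\<close> among the roots of
  \<open>P\<close>; conversely, \<open>P\<close> is the product of the linear factors over a finite
  spectrum.\<close>

lemma poly_hom_riesz_iff: "poly_hom_riesz T x \<longleftrightarrow> finite (hom_spectrum T x)"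
proof
  assume "poly_hom_riesz T x"
  then obtain P where P: "P \<noteq> 0" "alg_spectrum (alg_poly P (T x)) = {0}"
    by (auto simp: poly_hom_riesz_def hom_riesz_def quasinilpotents_def T_alg_poly)
  have "hom_spectrum T x \<subseteq> {z. poly P z = 0}"
    using poly_spectrum[of _ "T x" P] P(2) by (auto simp: hom_spectrum_def)
  then show "finite (hom_spectrum T x)" using P(1) poly_roots_finite finite_subset by blast
next
  assume fin: "finite (hom_spectrum T x)"
  define P where "P = (\<Prod>l\<in>hom_spectrum T x. [:- l, 1:])"
  have P0: "P \<noteq> 0" unfolding P_def using fin by auto
  have roots: "poly P z = 0 \<longleftrightarrow> z \<in> hom_spectrum T x" for z
    unfolding P_def poly_prod using fin by (auto simp: prod_zero_iff)
  \<comment> \<open>Quasinilpotence asks for spectrum exactly \<open>{0}\<close>, so a spectral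
    point of \<open>T x\<close> is needed to show that 0 occurs; \<open>m\<close> also witnesses
    below that \<open>Q\<close> is nonzero.\<close>
  obtain m where m: "m \<in> alg_spectrum (T x)" using spectrum_nonempty by blast
  have "alg_spectrum (alg_poly P (T x)) = {0}"
  proof
    show "{0} \<subseteq> alg_spectrum (alg_poly P (T x))"
      using poly_spectrum[OF m, of P] roots[of m] m by (simp add: hom_spectrum_def)
    show "alg_spectrum (alg_poly P (T x)) \<subseteq> {0}"
    proof
      fix z assume z: "z \<in> alg_spectrum (alg_poly P (T x))"
      show "z \<in> {0}"
      proof (rule ccontr)
        assume "z \<notin> {0}"
        define Q where "Q = P + [:- z:]"
        have "poly Q m \<noteq> 0" using \<open>z \<notin> {0}\<close> roots[of m] m by (simp add: Q_def hom_spectrum_def)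
        then have "Q \<noteq> 0" by auto
        moreover have "r \<notin> alg_spectrum (T x)" if "poly Q r = 0" for r
        proof
          assume "r \<in> alg_spectrum (T x)"
          then show False using roots[of r] that \<open>z \<notin> {0}\<close> by (simp add: Q_def hom_spectrum_def)
        qed
        ultimately have "alg_poly Q (T x) \<in> invertible_elems" by (rule alg_poly_invertible)
        then have "alg_poly P (T x) - z *\<^sub>C 1 \<in> invertible_elems"
          by (simp add: Q_def alg_poly_add alg_poly_pCons scaleC.minus_left)
        then show False using z by (simp add: invertible_shift_iff)
      qed
    qed
  qed
  then show "poly_hom_riesz T x"
    unfolding poly_hom_riesz_def hom_riesz_def quasinilpotents_def T_alg_poly using P0 by blast
qed

text \<open>\<open>T p = ainv (T b) ^ N * T (b ^ N * p)\<close> for every \<open>N\<close>, and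
  boundedness of \<open>T\<close> transfers the decay of \<open>b ^ N * p\<close>, which beats every
  geometric growth for suitable \<open>N\<close>.\<close>

lemma T_locally_quasinilpotent_zero:
  assumes "locally_quasinilpotent b p" "T b \<in> invertible_elems"
  shows "T p = 0"
proof -
  obtain K where K: "0 < K" "\<And>x. norm (T x) \<le> norm x * K"
    using bounded_linear.pos_bounded[OF bounded] by blast
  show ?thesis
  proof (rule locally_quasinilpotent_vanish[OF assms(1), of "norm (ainv (T b))" _ K])
    fix N :: nat
    have "T p = ainv (T b) ^ N * T (b ^ N * p)"
      using ainv_power_mult[OF assms(2), of N] by (simp add: T_simps T_power flip: mult.assoc)
    then have "norm (T p) \<le> norm (ainv (T b) ^ N) * norm (T (b ^ N * p))"
      by (metis norm_mult_ineq)
    also have "\<dots> \<le> norm (ainv (T b)) ^ N * (norm (b ^ N * p) * K)"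
      by (intro mult_mono norm_power_ineq K) auto
    finally show "norm (T p) \<le> K * (norm (ainv (T b)) ^ N * norm (b ^ N * p))"
      by (simp add: mult_ac)
  qed simp
qed

end

text \<open>On the range of \<open>p\<close>, \<open>a - m' *\<^sub>C 1\<close> is a nonzero scalar
  plus a quasinilpotent, hence invertible. So \<open>p = v ^ N * (b' ^ N * p)\<close>, and
  multiplying by \<open>p'\<close> brings in the decay of \<open>b' ^ N * p'\<close>.\<close>

lemma locally_quasinilpotent_disjoint:
  fixes a p p' :: "'a::complex_banach_algebra_1"
  assumes "m \<noteq> m'"
    and p: "p * p = p" "\<And>x. x * a = a * x \<Longrightarrow> x * p = p * x"
      "locally_quasinilpotent (a - m *\<^sub>C 1) p"
    and p': "\<And>x. x * a = a * x \<Longrightarrow> x * p' = p' * x" "locally_quasinilpotent (a - m' *\<^sub>C 1) p'"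
  shows "p * p' = 0"
proof -
  define b where "b = a - m *\<^sub>C 1"
  define b' where "b' = a - m' *\<^sub>C 1"
  define z where "z = 1 / (m' - m)"
  have z: "z * (m' - m) = 1" using assms(1) by (simp add: z_def)
  have ap: "a * p = p * a" and ap': "a * p' = p' * a" using p(2) p'(1) by simp_all
  have comm: "b * p = p * b" "b * p' = p' * b" "b' * p = p * b'" "p * p' = p' * p"
    using p'(1)[of p] ap by (simp_all add: b_def b'_def algebra_simps ap ap' scaleC_assoc)
  define w where "w = 1 - z *\<^sub>C (b * p)"
  have w: "w \<in> invertible_elems"
    unfolding w_def using p(1,3) comm(1)
    by (intro invertible_one_minus_locally_quasinilpotent) (simp_all add: b_def)
  have wp: "w * p = - (z *\<^sub>C (b' * p))"
  proof -
    have "(m' - m) *\<^sub>C p - b * p = - (b' * p)"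
      by (simp add: b_def b'_def left_diff_distrib scaleC_assoc scaleC.diff_left)
    then have "z *\<^sub>C ((m' - m) *\<^sub>C p - b * p) = - (z *\<^sub>C (b' * p))"
      by (simp add: scaleC.minus_right)
    then show ?thesis
      by (simp add: w_def left_diff_distrib scaleC_assoc mult.assoc p(1) scaleC.diff_right z)
  qed
  define v where "v = - (z *\<^sub>C ainv w)"
  have step: "p = v * (b' * p)"
  proof -
    have "p = ainv w * (w * p)" by (simp add: ainv_cancel w)
    then show ?thesis by (simp add: wp v_def scaleC_assoc)
  qed
  have iter: "p = v ^ N * (b' ^ N * p)" for N
  proof (induction N)
    case (Suc N)
    have bN: "b' ^ N * p = p * b' ^ N" using power_commuting_commutes[OF comm(3)] .
    have "v ^ N * (b' ^ N * p) = v ^ N * (p * b' ^ N)" by (simp only: bN)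
    also have "\<dots> = v ^ N * (v * (b' * p) * b' ^ N)" using step by (metis (no_types))
    also have "\<dots> = v ^ Suc N * (b' ^ Suc N * p)"
      by (simp only: mult.assoc power_Suc2[of v] power_Suc[of b'] bN)
    finally show ?case using Suc by simp
  qed simp
  show ?thesis
  proof (rule locally_quasinilpotent_vanish[OF p'(2), of "norm v" _ "norm p"])
    fix N :: nat
    have bN: "b' ^ N * p = p * b' ^ N" using power_commuting_commutes[OF comm(3)] .
    have "p * p' = v ^ N * (b' ^ N * p) * p'" using iter[of N] by simp
    also have "\<dots> = v ^ N * (p * (b' ^ N * p'))" by (simp only: bN mult.assoc)
    also have "norm \<dots> \<le> norm (v ^ N) * (norm p * norm (b' ^ N * p'))"
      by (meson norm_mult_ineq mult_left_mono norm_ge_zero order_trans)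
    also have "\<dots> \<le> norm v ^ N * (norm p * norm (b' ^ N * p'))"
      by (intro mult_right_mono norm_power_ineq) auto
    finally show "norm (p * p') \<le> norm p * (norm v ^ N * norm ((a - m' *\<^sub>C 1) ^ N * p'))"
      by (simp add: mult_ac b'_def)
  qed simp
qed

section \<open>The strong Riesz property\<close>

locale strong_riesz_hom = bounded_unital_hom T
  for T :: "'a::complex_banach_algebra_1 \<Rightarrow> 'b::complex_banach_algebra_1" +
  fixes a :: 'a
  assumes strong_riesz: "strong_riesz_property T"
    and finite_hom_spectrum: "finite (hom_spectrum T a)"
begin

text \<open>The boundary consists of finitely many points and of isolated points, so it is
  countable. The spectrum is then all boundary, and the strong Riesz property applies to each of its
  points.\<close>

lemma spectrum_isolated:
  assumes "l \<in> alg_spectrum a" "l \<notin> hom_spectrum T a"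
  shows "l isolated_in alg_spectrum a"
proof -
  have fr: "frontier (alg_spectrum a) \<subseteq> hom_spectrum T a \<union> iso_points (alg_spectrum a)"
    using strong_riesz by (simp add: strong_riesz_property_def)
  then have "countable (frontier (alg_spectrum a))"
    by (rule countable_subset)
      (simp add: finite_hom_spectrum countable_finite countable_iso_points)
  from frontier_subset_imp_subset[OF bounded_spectrum closed_spectrum this] fr assms
  show ?thesis by (auto simp: iso_points_def)
qed

lemma kernel_idempotent:
  assumes "l \<in> alg_spectrum a - hom_spectrum T a"
  shows "\<exists>p. p * p = p \<and> (\<forall>x. x * a = a * x \<longrightarrow> x * p = p * x) \<and>
    locally_quasinilpotent (a - l *\<^sub>C 1) p \<and> a - l *\<^sub>C 1 + p \<in> invertible_elems \<and> T p = 0"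
proof -
  define b where "b = a - l *\<^sub>C 1"
  obtain r where r: "0 < r" "\<And>z. z \<in> alg_spectrum a \<Longrightarrow> dist l z < r \<Longrightarrow> z = l"
    using spectrum_isolated[of l] assms unfolding isolated_in_dist_Ex_iff by blast
  \<comment> \<open>Isolation gives an open disc of radius \<open>r\<close>; halving the radius
    gives the closed disc needed for \<open>spectral_idempotent\<close>.\<close>
  have r2: "0 < r / 2" using r(1) by simp
  have ns: "z \<notin> alg_spectrum b" if z: "z \<noteq> 0" "norm z \<le> r / 2" for z
  proof
    assume "z \<in> alg_spectrum b"
    then have "z + l = l" using z(2) r(1) by (intro r(2)) (auto simp: b_def spectrum_shift dist_norm)
    then show False using z(1) by simp
  qed
  obtain p where p: "p * p = p" "\<And>x. x * b = b * x \<Longrightarrow> x * p = p * x"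
    "locally_quasinilpotent b p" "b + p \<in> invertible_elems"
  proof (rule spectral_idempotent[OF r2, of b])
    show "z \<notin> alg_spectrum b" if "z \<noteq> 0" "norm z \<le> r / 2" for z using that by (rule ns)
  qed (rule that; blast)
  have "T b = T a - l *\<^sub>C 1" by (simp add: b_def T_diff T_simps)
  then have "T b \<in> invertible_elems"
    using assms by (simp add: hom_spectrum_def invertible_shift_iff)
  then have Tp: "T p = 0" using T_locally_quasinilpotent_zero p(3) by blast
  have comm: "x * b = b * x" if "x * a = a * x" for x
    using that by (simp add: b_def left_diff_distrib right_diff_distrib scaleC_assoc)
  show ?thesis
    by (rule exI[of _ p]) (intro conjI allI impI p(1,2) comm p(3,4)[unfolded b_def] Tp)
qed

lemma weyl_spectrum_eq: "weyl_spectrum T a = hom_spectrum T a"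
proof
  show "weyl_spectrum T a \<subseteq> hom_spectrum T a"
  proof (rule subsetI, rule ccontr)
    fix l assume l: "l \<in> weyl_spectrum T a" "l \<notin> hom_spectrum T a"
    have "l \<in> alg_spectrum a"
    proof (rule ccontr)
      assume "l \<notin> alg_spectrum a"
      then have "l *\<^sub>C 1 - a = 0 + (l *\<^sub>C 1 - a) \<and> l *\<^sub>C 1 - a \<in> invertible_elems"
        by (simp add: alg_spectrum_def)
      then have "l *\<^sub>C 1 - a \<in> hom_weyl T"
        unfolding hom_weyl_def hom_kernel_def using T_zero by blast
      then show False using l by (simp add: weyl_spectrum_def)
    qed
    then obtain p where p: "a - l *\<^sub>C 1 + p \<in> invertible_elems" "T p = 0"
      using kernel_idempotent[of l] l by blast
    \<comment> \<open>The spectral idempotent is itself the kernel summand of the Weyl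
      decomposition.\<close>
    have "l *\<^sub>C 1 - a = p + - (a - l *\<^sub>C 1 + p)" by simp
    moreover have "- (a - l *\<^sub>C 1 + p) \<in> invertible_elems" using p by (simp only: invertible_uminus)
    ultimately have "l *\<^sub>C 1 - a \<in> hom_weyl T"
      unfolding hom_weyl_def hom_kernel_def using p(2) by blast
    then show False using l by (simp add: weyl_spectrum_def)
  qed
qed (rule hom_spectrum_subset_weyl)

text \<open>Spectral points at distance at least \<open>\<epsilon>\<close> from
  \<open>hom_spectrum T a\<close> form a compact set of isolated points.\<close>

lemma finite_far_spectrum:
  assumes "0 < \<epsilon>"
  shows "finite {l \<in> alg_spectrum a - hom_spectrum T a. \<epsilon> \<le> infdist l (hom_spectrum T a)}"
proof -
  define A where "A = alg_spectrum a \<inter> {l. \<epsilon> \<le> infdist l (hom_spectrum T a)}"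
  have "closed {l. \<epsilon> \<le> infdist l (hom_spectrum T a)}"
    by (intro closed_Collect_le continuous_intros)
  then have "compact A"
    unfolding A_def by (intro compact_Int_closed) (simp_all add: compact_eq_bounded_closed
        bounded_spectrum closed_spectrum)
  moreover have "\<not> l islimpt A" if "l \<in> A" for l
  proof -
    have "l \<notin> hom_spectrum T a" using that assms by (auto simp: A_def)
    then have "l isolated_in alg_spectrum a" using that spectrum_isolated by (auto simp: A_def)
    then show ?thesis by (auto simp: isolated_in_islimpt_iff A_def intro: islimpt_subset)
  qed
  ultimately have "finite A" using finite_not_islimpt_in_compact[of A A] by simp
  then show ?thesis by (rule finite_subset[rotated]) (auto simp: A_def)
qed

end

section \<open>The spectral family of \<open>a\<close> and its correction in the kernel\<close>

theorem kernel_perturbation_spectrum: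
  fixes T :: "'a::cstar_algebra_1 \<Rightarrow> 'b::complex_banach_algebra_1"
  assumes "strong_riesz_hom T a"
  obtains c where "T c = 0" "alg_spectrum (a - c) = weyl_spectrum T a"
proof -
  interpret strong_riesz_hom T a by fact
  define \<Lambda> where "\<Lambda> = hom_spectrum T a"
  define S where "S = alg_spectrum a - \<Lambda>"
  have \<Lambda>: "finite \<Lambda>" "\<Lambda> \<noteq> {}" "closed \<Lambda>"
    using finite_hom_spectrum spectrum_nonempty by (auto simp: \<Lambda>_def hom_spectrum_def finite_imp_closed)
  have "\<forall>l\<in>S. \<exists>p. p * p = p \<and> (\<forall>x. x * a = a * x \<longrightarrow> x * p = p * x) \<and>
    locally_quasinilpotent (a - l *\<^sub>C 1) p \<and> a - l *\<^sub>C 1 + p \<in> invertible_elems \<and> T p = 0"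
    using kernel_idempotent unfolding S_def \<Lambda>_def by (rule ballI)
  then obtain p where "\<forall>l\<in>S. p l * p l = p l \<and> (\<forall>x. x * a = a * x \<longrightarrow> x * p l = p l * x) \<and>
    locally_quasinilpotent (a - l *\<^sub>C 1) (p l) \<and> a - l *\<^sub>C 1 + p l \<in> invertible_elems \<and> T (p l) = 0"
    by (rule bchoice[THEN exE])
  then have p: "\<And>l. l \<in> S \<Longrightarrow> p l * p l = p l"
    "\<And>l x. l \<in> S \<Longrightarrow> x * a = a * x \<Longrightarrow> x * p l = p l * x"
    "\<And>l. l \<in> S \<Longrightarrow> locally_quasinilpotent (a - l *\<^sub>C 1) (p l)"
    "\<And>l. l \<in> S \<Longrightarrow> a - l *\<^sub>C 1 + p l \<in> invertible_elems"
    "\<And>l. l \<in> S \<Longrightarrow> T (p l) = 0"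
    by blast+
  have "\<exists>k\<in>\<Lambda>. infdist l \<Lambda> = dist l k" for l using infdist_attains_inf[OF \<Lambda>(3,2)] by metis
  then obtain near where near: "\<And>l. near l \<in> \<Lambda>" "\<And>l. infdist l \<Lambda> = dist l (near l)" by metis
  have "S \<subseteq> iso_points (alg_spectrum a)"
    using spectrum_isolated by (auto simp: S_def \<Lambda>_def iso_points_def)
  then have "countable S" using countable_iso_points countable_subset by blast
  then obtain g :: "complex \<Rightarrow> nat" where g: "inj_on g S" by (auto simp: countable_def)
  define D where "D = g ` S"
  define inv where "inv = inv_into S g"
  have inv: "inv n \<in> S" "g (inv n) = n" if "n \<in> D" for n
    using that by (simp_all add: inv_def D_def inv_into_into f_inv_into_f)
  have inv_g: "inv (g l) = l" if "l \<in> S" for l using that g by (simp add: inv_def)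
  obtain l0 where l0: "l0 \<in> \<Lambda>" using \<Lambda>(2) by blast
  \<comment> \<open>Indices outside \<open>D\<close> are padding: the idempotent is 0 and both
    values equal \<open>l0\<close>, so the shift vanishes and the target stays in
    \<open>\<Lambda>\<close>.\<close>
  define \<mu> where "\<mu> n = (if n \<in> D then inv n else l0)" for n
  define \<nu> where "\<nu> n = (if n \<in> D then near (inv n) else l0)" for n
  define P where "P n = (if n \<in> D then p (inv n) else 0)" for n
  have orthP: "P m * P n = 0" if "m \<noteq> n" for m n
  proof (cases "m \<in> D \<and> n \<in> D")
    case True
    then have mn: "inv m \<noteq> inv n" "inv m \<in> S" "inv n \<in> S" using inv that by metis+
    have "p (inv m) * p (inv n) = 0"
      using mn by (intro locally_quasinilpotent_disjoint[of "inv m" "inv n" _ a] p)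
    then show ?thesis using True by (simp add: P_def)
  qed (auto simp: P_def)
  interpret discrete_spectral_family a P \<mu> \<nu> \<Lambda>
  proof
    fix m n :: nat
    show "P n * P n = P n" by (simp add: P_def p(1) inv(1))
    show "a * P n = P n * a" using p(2)[OF inv(1) refl] by (simp add: P_def)
    show "locally_quasinilpotent (a - \<mu> n *\<^sub>C 1) (P n)"
    proof (cases "n \<in> D")
      case True
      then show ?thesis by (simp add: P_def \<mu>_def p(3) inv(1))
    next
      case False
      then show ?thesis by (auto simp: P_def locally_quasinilpotent_def intro!: exI[of _ 1])
    qed
    show "\<nu> n \<in> \<Lambda>" using near l0 by (simp add: \<nu>_def)
    show "P m * P n = 0" if "m \<noteq> n" using orthP that .
  next
    show "(\<lambda>n. \<mu> n - \<nu> n) \<longlonglongrightarrow> 0"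
    proof (rule tendsto_norm_zero_cancel, rule order_tendstoI)
      fix \<epsilon> :: real assume "0 < \<epsilon>"
      have "{n. \<epsilon> \<le> norm (\<mu> n - \<nu> n)} \<subseteq> g ` {l \<in> S. \<epsilon> \<le> infdist l \<Lambda>}"
      proof
        fix n assume n: "n \<in> {n. \<epsilon> \<le> norm (\<mu> n - \<nu> n)}"
        then have "n \<in> D" using \<open>0 < \<epsilon>\<close> by (cases "n \<in> D") (auto simp: \<mu>_def \<nu>_def)
        with n show "n \<in> g ` {l \<in> S. \<epsilon> \<le> infdist l \<Lambda>}"
          using inv[OF \<open>n \<in> D\<close>]
          by (intro image_eqI[of _ _ "inv n"]) (auto simp: \<mu>_def \<nu>_def near(2) dist_norm)
      qed
      moreover have "finite (g ` {l \<in> S. \<epsilon> \<le> infdist l \<Lambda>})"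
        using finite_far_spectrum[OF \<open>0 < \<epsilon>\<close>] by (simp add: S_def \<Lambda>_def)
      ultimately have "finite {n. \<epsilon> \<le> norm (\<mu> n - \<nu> n)}" using finite_subset by blast
      then show "\<forall>\<^sub>F n in sequentially. norm (\<mu> n - \<nu> n) < \<epsilon>"
        by (simp add: cofinite_eq_sequentially[symmetric] eventually_cofinite not_less)
    qed (auto intro!: always_eventually elim: order.strict_trans2)
    show "finite \<Lambda>" by (rule \<Lambda>)
    show "\<exists>m z. (l *\<^sub>C 1 - a) * z = 1 - (\<Sum>i<m. P i)" if l: "l \<notin> \<Lambda>" for l
    proof (cases "l \<in> S")
      case False
      then have "l *\<^sub>C 1 - a \<in> invertible_elems" using l by (simp add: S_def alg_spectrum_def)
      from ainv(1)[OF this] show ?thesis by (intro exI[of _ 0] exI[of _ "ainv (l *\<^sub>C 1 - a)"]) simp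
    next
      case True
      define b where "b = a - l *\<^sub>C 1"
      define w where "w = b + p l"
      \<comment> \<open>The upper limit \<open>Suc (g l)\<close> makes the sum contain the term
        \<open>p l\<close>, so that orthogonality gives \<open>p l * E = p l\<close>.\<close>
      define E where "E = (\<Sum>i<Suc (g l). P i)"
      have pl: "p l * p l = p l" "w \<in> invertible_elems" "a * p l = p l * a"
        using p(1,4)[OF True] p(2)[OF True refl] by (simp_all add: w_def b_def)
      have bp: "b * p l = p l * b" by (simp add: b_def algebra_simps pl(3) scaleC_assoc)
      have Pg: "P (g l) = p l" using True inv_g by (simp add: P_def D_def)
      have "p l * P i = (if i = g l then p l else 0)" for i
        using orthP[of "g l" i] by (auto simp: Pg pl(1))
      then have "p l * E = (\<Sum>i<Suc (g l). if i = g l then p l else 0)"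
        by (simp only: E_def sum_distrib_left)
      then have pE: "p l * E = p l" by (simp del: sum.lessThan_Suc)
      \<comment> \<open>On the complement of \<open>p l\<close>, \<open>b\<close> agrees with the
        invertible \<open>w\<close>; hence \<open>(1 - p l) * ainv w\<close> is a right inverse of
        \<open>b\<close> up to \<open>1 - p l\<close>, and \<open>1 - p l\<close> fixes
        \<open>1 - E\<close>.\<close>
      have "(l *\<^sub>C 1 - a) * (- ((1 - p l) * ainv w * (1 - E))) = b * (1 - p l) * ainv w * (1 - E)"
        by (simp add: b_def algebra_simps)
      also have "b * (1 - p l) = (1 - p l) * w"
        by (simp add: w_def algebra_simps bp pl(1))
      also have "(1 - p l) * w * ainv w * (1 - E) = (1 - p l) * (1 - E)"
        by (simp only: mult.assoc[of _ w] ainv(1)[OF pl(2)] mult_1_right)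
      also have "\<dots> = 1 - E" by (simp add: algebra_simps pE)
      finally show ?thesis unfolding E_def by blast
    qed
  qed
  \<comment> \<open>\<open>T\<close> need not respect \<open>star\<close>, but \<open>e n\<close> is
    a factor of \<open>s n\<close>, so the kernel, being an ideal, contains every
    \<open>s n\<close>; it is closed because \<open>T\<close> is bounded, so it contains
    \<open>c\<close>.\<close>
  have TP: "T (P n) = 0" for n by (simp add: P_def T_zero p(5) inv(1))
  have "T (e n) = 0" for n by (induction n) (simp_all add: e_Suc T_simps TP, simp add: e_def T_zero)
  then have "T (s n) = 0" for n by (simp add: s_def range_proj_def T_simps)
  then have "T (q n) = 0" for n by (simp add: q_def T_diff)
  then have "T (C n) = 0" for n
    by (induction n) (simp_all add: C_def T_simps T_zero scaleC.zero_right)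
  moreover have "(\<lambda>n. T (C n)) \<longlonglongrightarrow> T c" by (rule bounded_linear.tendsto[OF bounded C_tendsto])
  ultimately have Tc: "T c = 0" by (simp add: LIMSEQ_const_iff)
  \<comment> \<open>As \<open>T\<close> does not see \<open>c\<close>, the points of
    \<open>\<Lambda>\<close> cannot leave the spectrum.\<close>
  have "hom_spectrum T (a - c) = hom_spectrum T a" by (simp add: hom_spectrum_def T_diff Tc)
  then have "\<Lambda> \<subseteq> alg_spectrum (a - c)" using hom_spectrum_subset[of "a - c"] by (simp add: \<Lambda>_def)
  then have "alg_spectrum (a - c) = weyl_spectrum T a"
    using spectrum_minus_diagonal by (auto simp: weyl_spectrum_eq \<Lambda>_def)
  with Tc show ?thesis by (rule that)
qed

theorem theorem2p2:
  fixes T :: "'a::cstar_algebra_1 \<Rightarrow> 'b::cstar_algebra_1" and a :: 'a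
  assumes "unital_hom T"
    and "bounded_linear T"
    and "strong_riesz_property T"
  shows "(poly_hom_riesz T a \<longleftrightarrow> finite (weyl_spectrum T a)) \<and>
    (poly_hom_riesz T a \<longrightarrow>
      (\<exists>c d f. a = c + d + f \<and> c \<in> hom_kernel T \<and> d \<in> quasinilpotents \<and>
        alg_spectrum f = weyl_spectrum T a))"
proof -
  interpret bounded_unital_hom T using assms(1,2) by (rule bounded_unital_hom.intro)
  have weyl: "strong_riesz_hom T a" if "finite (hom_spectrum T a)"
    using bounded_unital_hom_axioms assms(3) that
    by (intro strong_riesz_hom.intro strong_riesz_hom_axioms.intro)
  have "finite (weyl_spectrum T a)" if "finite (hom_spectrum T a)"
    using strong_riesz_hom.weyl_spectrum_eq[OF weyl[OF that]] that by simp
  \<comment> \<open>Finiteness of the Weyl spectrum passes to the smaller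
    \<open>hom_spectrum T a\<close>, and the two coincide once the latter is finite.\<close>
  then have iff: "poly_hom_riesz T a \<longleftrightarrow> finite (weyl_spectrum T a)"
    using finite_subset[OF hom_spectrum_subset_weyl] poly_hom_riesz_iff by blast
  moreover have "\<exists>c d f. a = c + d + f \<and> c \<in> hom_kernel T \<and> d \<in> quasinilpotents \<and>
      alg_spectrum f = weyl_spectrum T a" if "poly_hom_riesz T a"
  proof -
    have "strong_riesz_hom T a" using that by (intro weyl) (simp add: poly_hom_riesz_iff)
    then obtain c where c: "T c = 0" "alg_spectrum (a - c) = weyl_spectrum T a"
      by (rule kernel_perturbation_spectrum)
    have "alg_spectrum (0::'a) \<subseteq> {0}" using spectrum_norm_le[of _ "0::'a"] by auto
    then have "(0::'a) \<in> quasinilpotents"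
      using spectrum_nonempty[of "0::'a"] by (auto simp: quasinilpotents_def)
    moreover have "a = c + 0 + (a - c)" by simp
    ultimately show ?thesis using c unfolding hom_kernel_def by blast
  qed
  ultimately show ?thesis by blast
qed

end
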